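(* Consider the stochastic first-order method described in the context with proximal function $\phi=\delta_{\{\mathbf z:\|\mathbf z\|_1\le\psi\}}$ (the indicator function of the $\ell_1$-ball of radius $\psi>0$ centred at the origin), variance-reduced gradient estimates $G^k$ (with interval length $q_0$ and batch sizes $m_1,m$) as described in the context, constant stepsize $\eta_k\equiv\eta>0$, and $p_k\equiv1/K$; suppose that the assumptions (i)–(iv) in the context hold. With $\Omega=e^2\log d$, let $$\eta=\frac1L,\quad K=\left\lceil\frac{\Delta_fL}{\epsilon^2}\right\rceil,\quad m_1=\left\lceil\frac{\Omega e^2(\log d)\sigma_\infty^2}{\epsilon^2}\right\rceil,\quad m=\Omega^2q_0,\quad mq_0=m_1,\quad t=\frac1L,\quad \psi=\frac\epsilon L,$$ where $t$ is an auxiliary analysis parameter described in the context. Then $$\mathbb E\big[\mathrm{dist}_{\|\cdot\|_\infty}(0,\partial(f+\delta_X)(\mathbf x^{Y+1}))\big]\le C_3\,\epsilon,$$ where $C_3$ is an absolute constant independent of any parameter of the algorithm or the problem data. The sample complexity is upper bounded by $$\mathcal O\left(\frac{\Delta_fL(\log d)^2\sigma_\infty}{\epsilon^3}\right).$$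
   Context: Problem: minimize $f(\mathbf x)=\mathbb E[F(\mathbf x,\zeta)]$ over $\mathbf x\in X$, where $X\subseteq\mathbb R^d$ is closed and convex, $\zeta$ is a random vector with values in $\Xi$, the expectation is well defined and finite for every $\mathbf x\in\mathbb R^d$, and $f$ is everywhere differentiable and possibly nonconvex. I.i.d. realizations of $\zeta$ can be generated. $F(\cdot,\zeta)$ is everywhere differentiable for all $\zeta\in\Xi$, and the stochastic gradient is $\nabla F(\mathbf x,\zeta)$, with $\mathbb E[\nabla F(\mathbf x,\zeta)]=\nabla f(\mathbf x)$ for all $\mathbf x\in X$. $\|\cdot\|$ is the Euclidean norm. Assumptions: (i) a stochastic first-order oracle is available, i.e. the stochastic gradient can be efficiently evaluated for any given $(\mathbf x,\zeta)$; (ii) $\sigma_\infty^2=\max_{\mathbf x\in X}\mathbb E[\|\nabla F(\mathbf x,\zeta)-\nabla f(\mathbf x)\|_\infty^2]<\infty$; (iii) for some constant $L\ge0$, $\mathbb E[\|\nabla F(\mathbf x,\zeta)-\nabla F(\mathbf y,\zeta)\|_\infty^2]\le L^2\|\mathbf x-\mathbf y\|_1^2$ for all $\mathbf x,\mathbf y\in X$; (iv) for some $\underline f\in\mathbb R$, $f(\mathbf x)\ge\underline f$ for all $\mathbf x\in X$. Set $\Delta_f=\mathbb E[f(\mathbf x^1)]-\underline f$. The number $\epsilon>0$ is the target accuracy. Algorithm: choose $\mathbf x^1\in X$, $K$, and stepsizes $\eta_k>0$. For $k=1,\dots,K$: generate the gradient estimate $G^k$ and set $$\mathbf x^{k+1}=\arg\min_{\mathbf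 x\in X}\left\{\tfrac12\|\mathbf x-(\mathbf x^k-\eta_kG^k)\|^2+\phi(\mathbf x-\mathbf x^k)\right\}.$$ Output $\mathbf x^{Y+1}$ for a randomly drawn index $Y$ (independent of the iterates) with $\mathbb P[Y=k]=p_k$, $k=1,\dots,K$. Variance-reduced estimate: given the interval length $q_0$, let $m_k=m_1$ if $k\equiv1\pmod{q_0}$ and $m_k=m$ otherwise; with $\zeta_i^k$ i.i.d. realizations of $\zeta$, independent of the algorithmic history, $$G^k=\begin{cases}\frac1{m_k}\sum_{i=1}^{m_k}\nabla F(\mathbf x^k,\zeta_i^k), & k\equiv1\pmod{q_0},\\ \frac1{m_k}\left(\sum_{i=1}^{m_k}\nabla F(\mathbf x^k,\zeta_i^k)-\sum_{i=1}^{m_k}\nabla F(\mathbf x^{k-1},\zeta_i^k)\right)+G^{k-1}, & \text{otherwise.}\end{cases}$$ The sample complexity is the total number of samples of $\zeta$ used. The parameter $t>0$ does not enter the algorithm; it appears in the error bound from which the result is deduced, namely that the expected residual $\mathbb E[\mathrm{dist}_{\|\cdot\|_\infty}(0,\partial(f+\delta_X)(\mathbf x^{Y+1}))]$ is at most $$\left(L+\tfrac1\eta+\sqrt{\tfrac{4\Omega^2L^2q_0}{m}}\right)\psi+\sqrt{\tfrac{\Omega e^2(\log d)\sigma_\infty^2}{m_1}}+\tfrac1\psi\left(\tfrac{\Delta_f}{K}+\tfrac{t\Omega e^2(\log d)\sigma_\infty^2}{2m_1}+\left(\tfrac{2t\Omega^2L^2q_0}{m}+\tfrac L2+\tfrac1{2t}\right)\psi^2\right).$$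 Notation: for a set $S$, $\delta_S$ is its indicator function ($0$ on $S$, $+\infty$ off $S$), $\partial$ is the Fréchet subdifferential, and $\mathrm{dist}_{\|\cdot\|_\infty}(0,S)=\inf\{\|\mathbf v\|_\infty:\mathbf v\in S\}$. *)

theory Defs
  imports "HOL-Probability.Probability" "HOL-Number_Theory.Cong"
begin

definition l1_norm :: "real ^ 'd \<Rightarrow> real" where
  "l1_norm x = (\<Sum>i\<in>UNIV. \<bar>x $ i\<bar>)"

text \<open>The max-norm on \<^typ>\<open>real ^ 'd\<close> is the library constant \<^const>\<open>infnorm\<close>.\<close>

definition grad :: "(real ^ 'd \<Rightarrow> real) \<Rightarrow> real ^ 'd \<Rightarrow> real ^ 'd" where
  "grad f x = (THE g. GDERIV f x :> g)"

text \<open>The indicator function in the sense of convex analysis.\<close>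

definition ind_fun :: "'a set \<Rightarrow> 'a \<Rightarrow> ereal" where
  "ind_fun S x = (if x \<in> S then 0 else \<infinity>)"

definition frechet_subdifferential :: "(real ^ 'd \<Rightarrow> ereal) \<Rightarrow> real ^ 'd \<Rightarrow> (real ^ 'd) set" where
  "frechet_subdifferential h x =
     {v. \<bar>h x\<bar> \<noteq> \<infinity> \<and>
         0 \<le> Liminf (at x) (\<lambda>y. (h y - h x - ereal (v \<bullet> (y - x))) / ereal (norm (y - x)))}"

text \<open>Distance of the origin to a set in the max-norm; it is infinite for the empty set.\<close>

definition infnorm_dist0 :: "(real ^ 'd) set \<Rightarrow> ennreal" where
  "infnorm_dist0 S = (INF v\<in>S. ennreal (infnorm v))"

text \<open>\<open>D\<close> is the law of the random vector, concentrated on its range \<open>\<Xi>\<close>.\<close>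

definition objective :: "'z measure \<Rightarrow> (real ^ 'd \<Rightarrow> 'z \<Rightarrow> real) \<Rightarrow> real ^ 'd \<Rightarrow> real" where
  "objective D F x = (\<integral>z. F x z \<partial>D)"

definition stoch_grad :: "(real ^ 'd \<Rightarrow> 'z \<Rightarrow> real) \<Rightarrow> real ^ 'd \<Rightarrow> 'z \<Rightarrow> real ^ 'd" where
  "stoch_grad F x z = grad (\<lambda>y. F y z) x"

text \<open>The second moments are Lebesgue integrals of nonnegative functions, so that the
  bounds include finiteness. The variance level is the supremum over \<open>X\<close>, which need not be
  attained.\<close>

locale stochastic_problem =
  fixes X :: "(real ^ 'd) set"
    and \<Xi> :: "'z::euclidean_space set"
    and D :: "'z measure"
    and F :: "real ^ 'd \<Rightarrow> 'z \<Rightarrow> real"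
    and L \<sigma> f_low :: real
  assumes X_closed: "closed X"
    and X_convex: "convex X"
    and D_prob: "prob_space D"
    and D_sets: "sets D = sets (restrict_space borel \<Xi>)"
    and F_integrable: "\<And>x. integrable D (F x)"
    and F_differentiable: "\<And>x z. z \<in> \<Xi> \<Longrightarrow> (\<lambda>y. F y z) differentiable (at x)"
    and f_differentiable: "\<And>x. objective D F differentiable (at x)"
    and unbiased: "\<And>x. x \<in> X \<Longrightarrow>
      has_bochner_integral D (stoch_grad F x) (grad (objective D F) x)"
    and sigma_nonneg: "0 \<le> \<sigma>"
    and variance: "(SUP x\<in>X. \<integral>\<^sup>+z. ennreal ((infnorm (stoch_grad F x z - grad (objective D F) x))\<^sup>2) \<partial>D)
      = ennreal (\<sigma>\<^sup>2)"
    and L_nonneg: "0 \<le> L"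
    and mean_square_smooth: "\<And>x y. x \<in> X \<Longrightarrow> y \<in> X \<Longrightarrow>
      (\<integral>\<^sup>+z. ennreal ((infnorm (stoch_grad F x z - stoch_grad F y z))\<^sup>2) \<partial>D)
      \<le> ennreal (L\<^sup>2 * (l1_norm (x - y))\<^sup>2)"
    and f_bounded_below: "\<And>x. x \<in> X \<Longrightarrow> f_low \<le> objective D F x"

definition batch :: "nat \<Rightarrow> nat \<Rightarrow> nat \<Rightarrow> nat \<Rightarrow> nat" where
  "batch q0 m1 m k = (if [k = 1] (mod q0) then m1 else m)"

text \<open>The pairs \<open>(k, i)\<close> for which a sample is drawn; the sample complexity is their number.\<close>

definition sample_indices :: "nat \<Rightarrow> nat \<Rightarrow> nat \<Rightarrow> nat \<Rightarrow> (nat \<times> nat) set" where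
  "sample_indices q0 m1 m K = (SIGMA k:{1..K}. {1..batch q0 m1 m k})"

definition sample_complexity :: "nat \<Rightarrow> nat \<Rightarrow> nat \<Rightarrow> nat \<Rightarrow> nat" where
  "sample_complexity q0 m1 m K = card (sample_indices q0 m1 m K)"

text \<open>Independence of two random variables whose value types may differ; the library constant
  \<open>indep_var\<close> forces both value types to be equal.\<close>

definition indep_rv ::
  "'w measure \<Rightarrow> 'a measure \<Rightarrow> ('w \<Rightarrow> 'a) \<Rightarrow> 'b measure \<Rightarrow> ('w \<Rightarrow> 'b) \<Rightarrow> bool" where
  "indep_rv M S U T V \<longleftrightarrow>
     U \<in> measurable M S \<and> V \<in> measurable M T \<and>
     prob_space.indep_set M {U -` A \<inter> space M | A. A \<in> sets S} {V -` B \<inter> space M | B. B \<in> sets T}"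

text \<open>A run of the method on the probability space \<open>M\<close>. The algorithmic history before the
  \<open>k\<close>-th batch consists of the iterates up to \<open>x k\<close> and all samples drawn earlier.
  The index \<open>Y\<close> is independent of the whole tuple of iterates. Both independence
  conditions include the measurability of the variables involved.\<close>

locale variance_reduced_method =
  fixes M :: "'w measure"
    and X :: "(real ^ 'd) set"
    and D :: "'z measure"
    and F :: "real ^ 'd \<Rightarrow> 'z \<Rightarrow> real"
    and \<phi> :: "real ^ 'd \<Rightarrow> ereal"
    and \<eta> p :: "nat \<Rightarrow> real"
    and K q0 m1 m :: nat
    and \<zeta> :: "nat \<Rightarrow> nat \<Rightarrow> 'w \<Rightarrow> 'z"
    and G x :: "nat \<Rightarrow> 'w \<Rightarrow> real ^ 'd"
    and Y :: "'w \<Rightarrow> nat"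
  assumes M_prob: "prob_space M"
    and sizes_pos: "0 < K" "0 < q0" "0 < m1" "0 < m"
    and stepsize_pos: "\<And>k. k \<in> {1..K} \<Longrightarrow> 0 < \<eta> k"
    and sample_law: "\<And>k i. (k, i) \<in> sample_indices q0 m1 m K \<Longrightarrow>
      \<zeta> k i \<in> measurable M D \<and> distr M D (\<zeta> k i) = D"
    and sample_indep: "\<And>k. k \<in> {1..K} \<Longrightarrow>
      prob_space.indep_vars M (\<lambda>_. D) (\<zeta> k) {1..batch q0 m1 m k}"
    and sample_fresh: "\<And>k. k \<in> {1..K} \<Longrightarrow>
      indep_rv M
        (Pi\<^sub>M {1..batch q0 m1 m k} (\<lambda>_. D))
        (\<lambda>\<omega>. \<lambda>i\<in>{1..batch q0 m1 m k}. \<zeta> k i \<omega>)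
        (Pi\<^sub>M {1..k} (\<lambda>_. borel) \<Otimes>\<^sub>M Pi\<^sub>M (sample_indices q0 m1 m (k - 1)) (\<lambda>_. D))
        (\<lambda>\<omega>. (\<lambda>j\<in>{1..k}. x j \<omega>,
               \<lambda>q\<in>sample_indices q0 m1 m (k - 1). \<zeta> (fst q) (snd q) \<omega>))"
    and start: "\<And>\<omega>. \<omega> \<in> space M \<Longrightarrow> x 1 \<omega> \<in> X"
    and estimate: "\<And>k \<omega>. k \<in> {1..K} \<Longrightarrow> \<omega> \<in> space M \<Longrightarrow>
      G k \<omega> =
        (if [k = 1] (mod q0)
         then (1 / real (batch q0 m1 m k)) *\<^sub>R
                (\<Sum>i = 1..batch q0 m1 m k. stoch_grad F (x k \<omega>) (\<zeta> k i \<omega>))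
         else (1 / real (batch q0 m1 m k)) *\<^sub>R
                ((\<Sum>i = 1..batch q0 m1 m k. stoch_grad F (x k \<omega>) (\<zeta> k i \<omega>))
                 - (\<Sum>i = 1..batch q0 m1 m k. stoch_grad F (x (k - 1) \<omega>) (\<zeta> k i \<omega>)))
              + G (k - 1) \<omega>)"
    and update: "\<And>k \<omega>. k \<in> {1..K} \<Longrightarrow> \<omega> \<in> space M \<Longrightarrow>
      is_arg_min
        (\<lambda>y. ereal (1 / 2 * (norm (y - (x k \<omega> - \<eta> k *\<^sub>R G k \<omega>)))\<^sup>2) + \<phi> (y - x k \<omega>))
        (\<lambda>y. y \<in> X) (x (k + 1) \<omega>)"
    and output_law: "\<And>k. k \<in> {1..K} \<Longrightarrow> measure M {\<omega> \<in> space M. Y \<omega> = k} = p k"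
    and output_indep: "indep_rv M (count_space UNIV) Y
      (Pi\<^sub>M {1..K + 1} (\<lambda>_. borel)) (\<lambda>\<omega>. \<lambda>k\<in>{1..K + 1}. x k \<omega>)"

definition Omega :: "nat \<Rightarrow> real" where
  "Omega d = (exp 1)\<^sup>2 * ln (real d)"

text \<open>The relations \<open>m = \<Omega>\<^sup>2 q\<^sub>0\<close> and \<open>m q\<^sub>0 = m\<^sub>1\<close> have the real solution
  \<open>q\<^sub>0 = sqrt m\<^sub>1 / \<Omega>\<close>, \<open>m = \<Omega>\<^sup>2 q\<^sub>0\<close>, which is in general not integral. The interval length and
  the batch size are therefore any integers obtained by rounding these values up or down;
  exact integral solutions are included.\<close>

definition parameter_choice ::
  "nat \<Rightarrow> real \<Rightarrow> real \<Rightarrow> real \<Rightarrow> real \<Rightarrow> real \<Rightarrow> real \<Rightarrow> nat \<Rightarrow> nat \<Rightarrow> nat \<Rightarrow> nat \<Rightarrow> bool" where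
  "parameter_choice d L \<sigma> \<Delta> \<epsilon> \<eta> \<psi> K q0 m1 m \<longleftrightarrow>
     \<eta> = 1 / L \<and>
     \<psi> = \<epsilon> / L \<and>
     K = nat \<lceil>\<Delta> * L / \<epsilon>\<^sup>2\<rceil> \<and>
     m1 = nat \<lceil>Omega d * (exp 1)\<^sup>2 * ln (real d) * \<sigma>\<^sup>2 / \<epsilon>\<^sup>2\<rceil> \<and>
     \<bar>real m - (Omega d)\<^sup>2 * real q0\<bar> < 1 \<and>
     \<bar>real q0 - sqrt (real m1) / Omega d\<bar> < 1 \<and>
     0 < K \<and> 0 < q0 \<and> 0 < m1 \<and> 0 < m"

text \<open>The absolute constants. The dimension is \<open>CARD('d)\<close> for a type variable, so an existential
  quantifier over the constants inside a theorem could not express that they are independent of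
  the dimension; closed numerals are independent of everything. The values are not optimised.\<close>

definition C3 :: real where
  "C3 = 100"

definition C_complexity :: real where
  "C_complexity = 1000"

end

theory Submission
  imports Defs
begin

text \<open>The vectors normal to \<open>X\<close> at \<open>x\<close> contain some \<open>v\<close> with \<open>infnorm (grad f x + v) \<le> c\<close> as soon as
  \<open>grad f x \<bullet> (y - x) \<ge> - c * l1_norm (y - x)\<close> for all \<open>y \<in> X\<close>. For the iterates such a variational
  inequality follows from the optimality of the proximal step, with a constant that consists of
  terms of order \<open>\<epsilon>\<close>, the error of the gradient estimate, and the decrease of \<open>f\<close> divided by \<open>\<psi>\<close>; the
  decreases telescope.

  The estimation error is a sum of martingale differences since the last restart. Its max-norm is
  controlled through the function \<open>\<mu> ln (\<Sum>i. 2 cosh (x\<^sub>i / \<mu>))\<close>, which lies above the max-norm, is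
  \<open>\<mu> ln (2 d)\<close> at the origin, and whose expectation grows by at most \<open>2 E|\<xi>|\<^sup>2 / \<mu>\<close> when a centered
  increment \<open>\<xi>\<close> is added. This replaces the p-norm argument behind the factor \<open>\<Omega>\<close>.\<close>

section \<open>Stationarity in the max-norm\<close>

text \<open>The max-norm is not smooth, and a detour through the Euclidean norm would cost powers of
  the dimension. Running the recursion for expectations on the smooth majorant itself, and returning
  to the max-norm only at the end, costs \<mu> ln (2 d) once per interval and not once per step.
  With \<mu> = \<epsilon> / \<Omega> this is of order \<epsilon>. Each increment since the restart
  has second moment of order (L \<psi>)^2 = \<epsilon>^2 because the proximal step is at most \<psi>
  in the l1-norm, and fewer than q0 of them, each averaged over m samples, again add order
  \<epsilon>. A single step may increase f. The bound on the residual is therefore kept linear in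
  the signed difference of consecutive objective values, divided by \<psi>, so that the sum still
  telescopes. The distance to the subdifferential is an infimum over a set that varies with the
  point, and its measurability is not evident. It is dominated pointwise by a supremum of quotients
  that is Borel in the iterate; only this function is averaged over the random index. The constants:
  error 10 \<epsilon> with 10 = 1 + 1 + 8, residual 24 \<epsilon> with 24 = 3 + 2 * 10 + 1.\<close>

lemma infnorm_le_iff_cart:
  fixes x :: "real ^ 'd"
  shows "infnorm x \<le> c \<longleftrightarrow> (\<forall>i. \<bar>x $ i\<bar> \<le> c)"
proof
  assume "infnorm x \<le> c"
  then show "\<forall>i. \<bar>x $ i\<bar> \<le> c" using component_le_infnorm_cart order_trans by blast
next
  assume "\<forall>i. \<bar>x $ i\<bar> \<le> c"
  then show "infnorm x \<le> c"
    unfolding infnorm_cart by (intro cSup_least) auto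
qed

lemma inner_le_infnorm_l1_norm:
  fixes v d :: "real ^ 'd"
  shows "\<bar>v \<bullet> d\<bar> \<le> infnorm v * l1_norm d"
proof -
  have "\<bar>v \<bullet> d\<bar> \<le> (\<Sum>i\<in>UNIV. \<bar>v $ i * d $ i\<bar>)"
    unfolding inner_vec_def by (simp add: sum_abs)
  also have "\<dots> \<le> (\<Sum>i\<in>UNIV. infnorm v * \<bar>d $ i\<bar>)"
    by (intro sum_mono) (simp add: abs_mult component_le_infnorm_cart mult_right_mono)
  also have "\<dots> = infnorm v * l1_norm d"
    by (simp add: l1_norm_def sum_distrib_left)
  finally show ?thesis .
qed

lemma l1_norm_nonneg: "0 \<le> l1_norm x"
  by (simp add: l1_norm_def sum_nonneg)

lemma l1_norm_scaleR: "l1_norm (c *\<^sub>R x) = \<bar>c\<bar> * l1_norm x"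
  by (simp add: l1_norm_def abs_mult sum_distrib_left)

lemma l1_norm_triangle: "l1_norm (x + y) \<le> l1_norm x + l1_norm y"
  unfolding l1_norm_def sum.distrib[symmetric] by (intro sum_mono) (simp add: abs_triangle_ineq)

lemma l1_norm_eq_0: "l1_norm x = 0 \<longleftrightarrow> x = 0"
  by (simp add: l1_norm_def sum_nonneg_eq_0_iff vec_eq_iff)

lemma l1_norm_0 [simp]: "l1_norm 0 = 0"
  by (simp add: l1_norm_eq_0)

lemma infnorm_le_l1_norm:
  fixes x :: "real ^ 'd" shows "infnorm x \<le> l1_norm x"
  unfolding infnorm_le_iff_cart l1_norm_def
  by (auto intro!: member_le_sum)

lemma continuous_on_l1_norm [continuous_intros]:
  "continuous_on S f \<Longrightarrow> continuous_on S (\<lambda>x. l1_norm (f x))"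
  unfolding l1_norm_def by (intro continuous_intros)

text \<open>\<open>grad\<close> is a definite description. Existence comes from representing the
  derivative as an inner product (its adjoint at 1), uniqueness from uniqueness of the
  derivative.\<close>

lemma gderiv_grad:
  fixes f :: "real ^ 'd \<Rightarrow> real"
  assumes "f differentiable (at x)"
  shows "GDERIV f x :> grad f x"
proof -
  obtain f' where f': "(f has_derivative f') (at x)"
    using assms by (auto simp: differentiable_def)
  then interpret bounded_linear f' by (rule has_derivative_bounded_linear)
  have "f' = (\<lambda>h. inner h (adjoint f' 1))"
    using adjoint_works[OF linear_axioms, of _ 1] by (auto simp: fun_eq_iff)
  then have *: "GDERIV f x :> adjoint f' 1"
    using f' unfolding gderiv_def by simp
  have "g = adjoint f' 1" if "GDERIV f x :> g" for g
  proof -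
    have "(\<lambda>h. inner h g) = (\<lambda>h. inner h (adjoint f' 1))"
      using has_derivative_unique that * unfolding gderiv_def by blast
    then have "\<forall>h. h \<bullet> g = h \<bullet> adjoint f' 1" by (simp add: fun_eq_iff)
    then show ?thesis by (simp only: vector_eq_ldot)
  qed
  then show ?thesis unfolding grad_def using * by (metis theI)
qed

text \<open>Convex duality: the two sets separated in the proof are the hypograph of \<open>d \<mapsto> -a \<bullet> d\<close> over
  \<open>X - x\<close> and the strict epigraph of \<open>c \<cdot> l1_norm\<close>; the slope of the separating hyperplane
  is \<open>a + v\<close>.\<close>

lemma normal_vector_of_l1_stationary:
  fixes X :: "(real ^ 'd) set"
  assumes "convex X" "x \<in> X" "0 \<le> c"
    and st: "\<And>y. y \<in> X \<Longrightarrow> - (c * l1_norm (y - x)) \<le> a \<bullet> (y - x)"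
  obtains v where "\<And>y. y \<in> X \<Longrightarrow> v \<bullet> (y - x) \<le> 0" "infnorm (a + v) \<le> c"
proof -
  define S where "S = {(d, r). x + d \<in> X \<and> r \<le> - (a \<bullet> d)}"
  define T where "T = {(d :: real^'d, r). c * l1_norm d < r}"
  have cS: "convex S"
    unfolding convex_alt
  proof (clarsimp simp: S_def)
    fix d d' :: "real^'d" and r r' u :: real
    assume h: "x + d \<in> X" "r \<le> - (a \<bullet> d)" "x + d' \<in> X" "r' \<le> - (a \<bullet> d')" "0 \<le> u" "u \<le> 1"
    have "x + ((1 - u) *\<^sub>R d + u *\<^sub>R d') = (1 - u) *\<^sub>R (x + d) + u *\<^sub>R (x + d')"
      by (simp add: algebra_simps)
    also have "\<dots> \<in> X" using h \<open>convex X\<close> by (simp add: convex_alt)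
    finally have 1: "x + ((1 - u) *\<^sub>R d + u *\<^sub>R d') \<in> X" .
    have "(1 - u) * r + u * r' \<le> (1 - u) * (- (a \<bullet> d)) + u * (- (a \<bullet> d'))"
      using h by (intro add_mono mult_left_mono) auto
    also have "\<dots> = - (a \<bullet> ((1 - u) *\<^sub>R d + u *\<^sub>R d'))" by (simp add: inner_simps)
    finally show "x + ((1 - u) *\<^sub>R d + u *\<^sub>R d') \<in> X \<and>
       (1 - u) * r + u * r' \<le> - (a \<bullet> ((1 - u) *\<^sub>R d + u *\<^sub>R d'))" using 1 by simp
  qed
  have cT: "convex T"
    unfolding convex_alt
  proof (clarsimp simp: T_def)
    fix d d' :: "real^'d" and r r' u :: real
    assume h: "c * l1_norm d < r" "c * l1_norm d' < r'" "0 \<le> u" "u \<le> 1"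
    have "c * l1_norm ((1 - u) *\<^sub>R d + u *\<^sub>R d') \<le> c * (l1_norm ((1 - u) *\<^sub>R d) + l1_norm (u *\<^sub>R d'))"
      using \<open>0 \<le> c\<close> by (intro mult_left_mono l1_norm_triangle)
    also have "\<dots> = (1 - u) * (c * l1_norm d) + u * (c * l1_norm d')"
      using h unfolding l1_norm_scaleR by (simp add: distrib_left mult.left_commute)
    also have "\<dots> < (1 - u) * r + u * r'"
    proof (cases "u = 0")
      case False
      have "(1 - u) * (c * l1_norm d) \<le> (1 - u) * r" using h by (intro mult_left_mono) auto
      moreover have "u * (c * l1_norm d') < u * r'" using h False by simp
      ultimately show ?thesis by linarith
    qed (use h in simp)
    finally show "c * l1_norm ((1 - u) *\<^sub>R d + u *\<^sub>R d') < (1 - u) * r + u * r'" .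
  qed
  have S0: "(0, 0) \<in> S" using \<open>x \<in> X\<close> by (simp add: S_def)
  have T1: "(0, 1) \<in> T" by (simp add: T_def)
  have "S \<inter> T = {}"
  proof (rule ccontr)
    assume "S \<inter> T \<noteq> {}"
    then obtain d r where "x + d \<in> X" "r \<le> - (a \<bullet> d)" "c * l1_norm d < r"
      by (auto simp: S_def T_def)
    then show False using st[of "x + d"] by simp
  qed
  then obtain w b where w: "w \<noteq> 0" and wS: "\<forall>z\<in>S. w \<bullet> z \<le> b" and wT: "\<forall>z\<in>T. w \<bullet> z \<ge> b"
    using separating_hyperplane_sets[OF cS cT] S0 T1 by blast
  obtain p \<beta> where w_eq: "w = (p, \<beta>)" by fastforce
  have b0: "b \<ge> 0" using wS S0 w_eq by force
  have T: "b \<le> p \<bullet> d + \<beta> * r" if "c * l1_norm d < r" for d r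
    using wT that w_eq by (force simp: T_def)
  \<comment> \<open>\<open>T\<close> is the strict epigraph; letting the height decrease to
    \<open>c * l1_norm d\<close> extends the inequality to its boundary.\<close>
  have T': "b \<le> p \<bullet> d + \<beta> * (c * l1_norm d)" for d
  proof (rule field_le_epsilon)
    fix e :: real assume "0 < e"
    define e' where "e' = e / (\<bar>\<beta>\<bar> + 1)"
    have "e' > 0" using \<open>0 < e\<close> by (simp add: e'_def)
    then have "b \<le> p \<bullet> d + \<beta> * (c * l1_norm d + e')" by (intro T) simp
    moreover have "\<beta> * e' \<le> e"
    proof -
      have "\<beta> * e' \<le> (\<bar>\<beta>\<bar> + 1) * e'" using \<open>e' > 0\<close> by (intro mult_right_mono) auto
      then show ?thesis by (simp add: e'_def)
    qed
    ultimately show "b \<le> p \<bullet> d + \<beta> * (c * l1_norm d) + e" by (simp add: algebra_simps)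
  qed
  \<comment> \<open>The origin lies in \<open>S\<close> and on the boundary of \<open>T\<close>, so
    the hyperplane passes through it.\<close>
  have b_eq: "b = 0" using T'[of 0] b0 by simp
  have "\<beta> > 0"
  proof -
    have "\<beta> \<ge> 0" using T[of 0 1] b0 by simp
    moreover have "\<beta> \<noteq> 0"
    proof
      \<comment> \<open>A vertical hyperplane would make \<open>p \<bullet> d\<close> nonnegative
        for every direction; d = -p then forces p = 0.\<close>
      assume "\<beta> = 0"
      then have "0 \<le> p \<bullet> (- p)" using T'[of "- p"] b_eq by simp
      then have "p = 0"
        by (metis inner_ge_zero inner_minus_right inner_eq_zero_iff neg_0_le_iff_le order_antisym)
      then show False using w w_eq \<open>\<beta> = 0\<close> by (simp add: zero_prod_def)
    qed
    ultimately show ?thesis by simp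
  qed
  define q where "q = (1 / \<beta>) *\<^sub>R p"
  have q1: "0 \<le> q \<bullet> d + c * l1_norm d" for d
  proof -
    have "0 \<le> (p \<bullet> d + \<beta> * (c * l1_norm d)) / \<beta>"
      using T'[of d] b_eq \<open>\<beta> > 0\<close> by (intro divide_nonneg_pos) auto
    also have "\<dots> = q \<bullet> d + c * l1_norm d" using \<open>\<beta> > 0\<close> by (simp add: q_def field_simps)
    finally show ?thesis .
  qed
  have q2: "q \<bullet> d \<le> a \<bullet> d" if "x + d \<in> X" for d
  proof -
    have "(d, - (a \<bullet> d)) \<in> S" using that by (simp add: S_def)
    then have "p \<bullet> d \<le> \<beta> * (a \<bullet> d)" using wS b_eq w_eq by force
    then show ?thesis using \<open>\<beta> > 0\<close> by (simp add: q_def field_simps)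
  qed
  have "infnorm q \<le> c"
    unfolding infnorm_le_iff_cart
  proof
    fix i
    have l: "l1_norm (axis i s :: real ^ 'd) = \<bar>s\<bar>" for s :: real
    proof -
      have "l1_norm (axis i s) = (\<Sum>j\<in>UNIV. if j = i then \<bar>s\<bar> else 0)"
        unfolding l1_norm_def by (intro sum.cong) (auto simp: axis_def)
      then show ?thesis by simp
    qed
    \<comment> \<open>The max-norm is dual to the l1-norm, and the unit vectors with both signs
      suffice to test it.\<close>
    show "\<bar>q $ i\<bar> \<le> c"
      using q1[of "axis i 1"] q1[of "axis i (-1)"] by (simp add: l inner_axis)
  qed
  then show ?thesis
    using q2 by (intro that[of "q - a"]) (auto simp: inner_diff_left dest: q2[of "_ - x"])
qed

text \<open>The difference quotient is compared with that of \<open>f\<close> alone, which tends to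
  0. At points of \<open>X\<close> subtracting \<open>v \<bullet> (y - x) \<le> 0\<close> can only
  increase the quotient, and off \<open>X\<close> the quotient is infinite.\<close>

lemma frechet_subdifferential_add_normal:
  fixes f :: "real ^ 'd \<Rightarrow> real"
  assumes "f differentiable (at x)" "x \<in> X"
    and v: "\<And>y. y \<in> X \<Longrightarrow> v \<bullet> (y - x) \<le> 0"
  shows "grad f x + v \<in> frechet_subdifferential (\<lambda>y. ereal (f y) + ind_fun X y) x"
proof -
  define Q where "Q y = (ereal (f y) + ind_fun X y - (ereal (f x) + ind_fun X x)
      - ereal ((grad f x + v) \<bullet> (y - x))) / ereal (norm (y - x))" for y
  define R where "R y = (f y - f x - (y - x) \<bullet> grad f x) / norm (y - x)" for y
  have "(f has_derivative (\<lambda>h. h \<bullet> grad f x)) (at x)"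
    using gderiv_grad[OF assms(1)] by (simp add: gderiv_def)
  then have "(\<lambda>y. norm (f y - f x - (y - x) \<bullet> grad f x) / norm (y - x)) \<midarrow>x\<rightarrow> 0"
    unfolding has_derivative_iff_norm by blast
  then have "(\<lambda>y. \<bar>R y\<bar>) \<midarrow>x\<rightarrow> 0" by (simp add: R_def abs_divide)
  then have R: "R \<midarrow>x\<rightarrow> 0" by (simp add: tendsto_rabs_zero_iff)
  have "0 = Liminf (at x) (\<lambda>y. ereal (R y))"
    using R by (intro lim_imp_Liminf[symmetric]) (auto simp: zero_ereal_def)
  also have "\<dots> \<le> Liminf (at x) Q"
  proof (rule Liminf_mono)
    have "ereal (R y) \<le> Q y" if "y \<noteq> x" for y
    proof (cases "y \<in> X")
      case True
      have "R y \<le> (f y - f x - (grad f x + v) \<bullet> (y - x)) / norm (y - x)"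
        unfolding R_def using v[OF True]
        by (intro divide_right_mono) (auto simp: inner_add_left inner_commute[of "y - x"])
      then show ?thesis using True assms(2) that by (simp add: Q_def ind_fun_def)
    next
      case False
      then show ?thesis using assms(2) that by (simp add: Q_def ind_fun_def)
    qed
    then show "\<forall>\<^sub>F y in at x. ereal (R y) \<le> Q y"
      by (auto simp: eventually_at_filter)
  qed
  finally show ?thesis
    using assms(2) unfolding frechet_subdifferential_def Q_def by (simp add: ind_fun_def)
qed

lemma infnorm_dist0_le_of_l1_stationary:
  fixes f :: "real ^ 'd \<Rightarrow> real"
  assumes "f differentiable (at x)" "convex X" "x \<in> X" "0 \<le> c"
    and "\<And>y. y \<in> X \<Longrightarrow> - (c * l1_norm (y - x)) \<le> grad f x \<bullet> (y - x)"
  shows "infnorm_dist0 (frechet_subdifferential (\<lambda>y. ereal (f y) + ind_fun X y) x) \<le> ennreal c"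
proof -
  obtain v where v: "\<And>y. y \<in> X \<Longrightarrow> v \<bullet> (y - x) \<le> 0" "infnorm (grad f x + v) \<le> c"
    using normal_vector_of_l1_stationary[OF assms(2-5)] by blast
  have "infnorm_dist0 (frechet_subdifferential (\<lambda>y. ereal (f y) + ind_fun X y) x)
      \<le> ennreal (infnorm (grad f x + v))"
    unfolding infnorm_dist0_def
    by (intro INF_lower frechet_subdifferential_add_normal assms v)
  also have "\<dots> \<le> ennreal c" using v by (intro ennreal_leI)
  finally show ?thesis .
qed

text \<open>The least constant c \<ge> 0 in the variational inequality at \<open>x\<close>. As a
  supremum over test points it is easier to measure than the distance. \<open>ennreal\<close>
  truncates negative quotients to 0, which matches the constraint on c.\<close>

definition l1_residual :: "(real ^ 'd \<Rightarrow> real) \<Rightarrow> (real ^ 'd) set \<Rightarrow> real ^ 'd \<Rightarrow> ennreal" where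
  "l1_residual f X x = (SUP y\<in>X - {x}. ennreal (- (grad f x \<bullet> (y - x)) / l1_norm (y - x)))"

lemma l1_residual_le_iff:
  assumes "0 \<le> c"
  shows "l1_residual f X x \<le> ennreal c \<longleftrightarrow>
    (\<forall>y\<in>X. - (c * l1_norm (y - x)) \<le> grad f x \<bullet> (y - x))"
proof -
  have *: "ennreal (- (grad f x \<bullet> (y - x)) / l1_norm (y - x)) \<le> ennreal c \<longleftrightarrow>
      - (c * l1_norm (y - x)) \<le> grad f x \<bullet> (y - x)" if "y \<noteq> x" for y
  proof -
    have "l1_norm (y - x) > 0"
      using that l1_norm_nonneg[of "y - x"] l1_norm_eq_0[of "y - x"] by simp
    then show ?thesis using assms by (simp only: ennreal_le_iff pos_divide_le_eq minus_le_iff)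
  qed
  show ?thesis unfolding l1_residual_def SUP_le_iff using * by force
qed

lemma infnorm_dist0_le_l1_residual:
  fixes f :: "real ^ 'd \<Rightarrow> real"
  assumes "f differentiable (at x)" "convex X" "x \<in> X"
  shows "infnorm_dist0 (frechet_subdifferential (\<lambda>y. ereal (f y) + ind_fun X y) x)
    \<le> l1_residual f X x"
proof (cases "l1_residual f X x")
  case (real c)
  then have "l1_residual f X x \<le> ennreal c" by simp
  then have "\<And>y. y \<in> X \<Longrightarrow> - (c * l1_norm (y - x)) \<le> grad f x \<bullet> (y - x)"
    using l1_residual_le_iff[OF real(1)] by blast
  from infnorm_dist0_le_of_l1_stationary[OF assms real(1) this] show ?thesis
    using real by simp
qed simp

text \<open>For a fixed test point the inequality defines a closed set of points x, because the
  gradient is continuous on \<open>X\<close>. Arbitrary intersections of closed sets are closed, so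
  the uncountable supremum does no harm. The extension by 0 only adds the open complement of
  \<open>X\<close> to each sublevel set.\<close>

lemma borel_measurable_l1_residual:
  fixes f :: "real ^ 'd \<Rightarrow> real"
  assumes "closed X" "continuous_on X (grad f)"
  shows "(\<lambda>x. if x \<in> X then l1_residual f X x else 0) \<in> borel_measurable borel"
    (is "?h \<in> _")
proof (rule borel_measurableI_le)
  fix c :: ennreal
  show "{x \<in> space borel. ?h x \<le> c} \<in> sets borel"
  proof (cases c)
    case (real r)
    have "closed {x \<in> X. - (r * l1_norm (y - x)) \<le> grad f x \<bullet> (y - x)}" for y
      by (intro continuous_on_closed_Collect_le continuous_intros assms)
    then have "closed (X \<inter> (\<Inter>y\<in>X. {x \<in> X. - (r * l1_norm (y - x)) \<le> grad f x \<bullet> (y - x)}))"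
      using assms by (intro closed_Int closed_INT) auto
    moreover have "{x \<in> space borel. ?h x \<le> c} =
        X \<inter> (\<Inter>y\<in>X. {x \<in> X. - (r * l1_norm (y - x)) \<le> grad f x \<bullet> (y - x)}) \<union> - X"
      using real by (auto simp: l1_residual_le_iff)
    moreover have "- X \<in> sets borel" using assms by auto
    ultimately show ?thesis by auto
  qed simp
qed

section \<open>A smooth majorant of the max-norm\<close>

text \<open>Second-order bounds for the exponential settle \<bar>a\<bar> \<le> 1; beyond that
  \<bar>a\<bar> \<le> a^2 suffices. The sharp exponent is a^2 / 2; the cruder one is the reason for
  the factor 2 in the quadratic term of \<open>soft_infnorm_add_le\<close>.\<close>

lemma cosh_le_exp_square: "cosh a \<le> exp (a\<^sup>2)" for a :: real
proof (cases "\<bar>a\<bar> \<le> 1")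
  case True
  have "exp \<bar>a\<bar> \<le> 1 + \<bar>a\<bar> + \<bar>a\<bar>\<^sup>2" using True by (intro exp_bound) auto
  moreover have "exp (- \<bar>a\<bar>) \<le> 1 - \<bar>a\<bar> + \<bar>a\<bar>\<^sup>2"
  proof -
    \<comment> \<open>The bound for exp (- \<bar>a\<bar>) is multiplied by exp \<bar>a\<bar>; the
      right-hand product collapses to 1 + \<bar>a\<bar>^3.\<close>
    have "(1 - \<bar>a\<bar> + \<bar>a\<bar>\<^sup>2) * exp \<bar>a\<bar> \<ge> (1 - \<bar>a\<bar> + \<bar>a\<bar>\<^sup>2) * (1 + \<bar>a\<bar>)"
    proof (intro mult_left_mono)
      have "\<bar>a\<bar> \<le> 1" by fact
      then show "0 \<le> 1 - \<bar>a\<bar> + \<bar>a\<bar>\<^sup>2" by (simp add: add_nonneg_nonneg)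
    qed simp
    also have "(1 - \<bar>a\<bar> + \<bar>a\<bar>\<^sup>2) * (1 + \<bar>a\<bar>) = 1 + \<bar>a\<bar> ^ 3"
      by (simp add: algebra_simps power2_eq_square power3_eq_cube)
    finally have "(1 - \<bar>a\<bar> + \<bar>a\<bar>\<^sup>2) * exp \<bar>a\<bar> \<ge> 1 + \<bar>a\<bar> ^ 3" .
    moreover have "0 \<le> \<bar>a\<bar> ^ 3" by (rule zero_le_power) simp
    ultimately have "(1 - \<bar>a\<bar> + \<bar>a\<bar>\<^sup>2) * exp \<bar>a\<bar> \<ge> 1" by linarith
    then show ?thesis by (simp add: exp_minus field_simps)
  qed
  ultimately have "cosh \<bar>a\<bar> \<le> 1 + a\<^sup>2" by (simp add: cosh_def)
  also have "\<dots> \<le> exp (a\<^sup>2)" by (simp add: exp_ge_add_one_self)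
  finally show ?thesis by simp
next
  case False
  have "cosh \<bar>a\<bar> \<le> exp \<bar>a\<bar>"
    using exp_le_cancel_iff[of "- \<bar>a\<bar>" "\<bar>a\<bar>"] by (simp add: cosh_def del: exp_le_cancel_iff)
  also have "\<dots> \<le> exp (a\<^sup>2)"
    using False mult_left_mono[of 1 "\<bar>a\<bar>" "\<bar>a\<bar>"] by (simp add: power2_eq_square)
  finally show ?thesis by simp
qed

text \<open>The log-sum-exp function, at temperature \<mu>, of the 2 d linear functionals x_i and
  -x_i whose maximum is the max-norm.\<close>

definition soft_infnorm :: "real \<Rightarrow> real ^ 'd \<Rightarrow> real" where
  "soft_infnorm \<mu> x = \<mu> * ln (\<Sum>i\<in>UNIV. 2 * cosh (x $ i / \<mu>))"

text \<open>The gradient of \<open>soft_infnorm \<mu>\<close>: the outer factor \<mu> cancels the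
  inner 1 / \<mu>, and the factors 2 cancel.\<close>

definition soft_sign :: "real \<Rightarrow> real ^ 'd \<Rightarrow> real ^ 'd" where
  "soft_sign \<mu> x = (\<chi> i. sinh (x $ i / \<mu>) / (\<Sum>j\<in>UNIV. cosh (x $ j / \<mu>)))"

lemma sum_cosh_pos: "0 < (\<Sum>i\<in>UNIV. 2 * cosh (x $ i))" for x :: "real ^ 'd"
  by (intro sum_pos) auto

text \<open>One summand is enough: 2 cosh t \<ge> exp \<bar>t\<bar>, and the others are
  positive.\<close>

lemma infnorm_le_soft_infnorm:
  fixes x :: "real ^ 'd"
  assumes "0 < \<mu>"
  shows "infnorm x \<le> soft_infnorm \<mu> x"
  unfolding infnorm_le_iff_cart
proof
  fix i
  have "exp (\<bar>x $ i\<bar> / \<mu>) \<le> 2 * cosh (\<bar>x $ i\<bar> / \<mu>)" by (simp add: cosh_def)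
  also have "\<dots> = 2 * cosh (x $ i / \<mu>)"
    using cosh_real_abs[of "x $ i / \<mu>"] assms by (simp add: abs_divide)
  also have "\<dots> \<le> (\<Sum>i\<in>UNIV. 2 * cosh (x $ i / \<mu>))"
    by (intro member_le_sum) auto
  finally have "\<bar>x $ i\<bar> / \<mu> \<le> ln (\<Sum>i\<in>UNIV. 2 * cosh (x $ i / \<mu>))"
    by (subst ln_ge_iff) (auto intro!: sum_pos)
  then show "\<bar>x $ i\<bar> \<le> soft_infnorm \<mu> x"
    using assms by (simp add: soft_infnorm_def field_simps)
qed

lemma soft_infnorm_nonneg: "0 < \<mu> \<Longrightarrow> 0 \<le> soft_infnorm \<mu> x"
  using infnorm_le_soft_infnorm[of \<mu> x] infnorm_pos_le[of x] by linarith

lemma soft_infnorm_0: "soft_infnorm \<mu> (0 :: real ^ 'd) = \<mu> * ln (2 * real CARD('d))"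
  by (simp add: soft_infnorm_def mult.commute)

lemma continuous_on_soft_infnorm: "continuous_on UNIV (soft_infnorm \<mu>)"
proof -
  have "(\<Sum>i\<in>UNIV. 2 * cosh (x $ i / \<mu>)) \<noteq> 0" for x :: "real ^ 'd"
    by (rule less_imp_neq[THEN not_sym]) (intro sum_pos, auto)
  then show ?thesis
    unfolding soft_infnorm_def[abs_def] divide_inverse by (intro continuous_intros) auto
qed

text \<open>The two-point inequality \<open>Z (x + y) + Z (x - y) \<le> 2 exp (|y|\<^sup>2) Z x\<close> for \<open>Z = \<Sum>i. 2 cosh x\<^sub>i\<close>
  replaces an estimate of the second derivative.\<close>

lemma ln_sum_cosh_add_le:
  fixes x y :: "real ^ 'd"
  defines "Z \<equiv> \<lambda>x :: real ^ 'd. \<Sum>i\<in>UNIV. 2 * cosh (x $ i)"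
  shows "ln (Z (x + y)) \<le> ln (Z x) + soft_sign 1 x \<bullet> y + 2 * (infnorm y)\<^sup>2"
proof -
  define b where "b = (infnorm y)\<^sup>2"
  define \<tau> where "\<tau> = soft_sign 1 x \<bullet> y"
  have pos: "0 < Z u" for u by (simp add: Z_def sum_cosh_pos)
  have \<tau>: "\<tau> * Z x = (\<Sum>i\<in>UNIV. 2 * sinh (x $ i) * y $ i)"
  proof -
    have "\<tau> = (\<Sum>i\<in>UNIV. 2 * sinh (x $ i) * y $ i / Z x)"
      unfolding \<tau>_def soft_sign_def inner_vec_def Z_def
      by (intro sum.cong) (auto simp: sum_distrib_left[symmetric])
    then have "\<tau> = (\<Sum>i\<in>UNIV. 2 * sinh (x $ i) * y $ i) / Z x"
      by (simp only: sum_divide_distrib)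
    then show ?thesis using pos[of x] by simp
  qed
  have "Z (x + y) + Z (x - y) = (\<Sum>i\<in>UNIV. 4 * (cosh (x $ i) * cosh (y $ i)))"
    by (simp add: Z_def cosh_add cosh_diff algebra_simps flip: sum.distrib)
  also have "\<dots> \<le> (\<Sum>i\<in>UNIV. 4 * (cosh (x $ i) * exp b))"
  proof (intro sum_mono mult_left_mono)
    fix i
    have "cosh (y $ i) \<le> exp ((y $ i)\<^sup>2)" by (rule cosh_le_exp_square)
    also have "\<dots> \<le> exp b"
      using component_le_infnorm_cart[of y i] by (simp add: b_def abs_le_square_iff[symmetric] real_abs_infnorm)
    finally show "cosh (y $ i) \<le> exp b" .
  qed auto
  also have "\<dots> = 2 * (exp b * Z x)"
    by (simp add: Z_def sum_distrib_left sum_distrib_right mult_ac)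
  finally have "(Z (x + y) + Z (x - y)) / 2 \<le> exp b * Z x" by simp
  then have "((Z (x + y) + Z (x - y)) / 2)\<^sup>2 \<le> (exp b * Z x)\<^sup>2"
    using pos[of "x + y"] pos[of "x - y"] by (intro power_mono) auto
  \<comment> \<open>The arithmetic-geometric mean inequality replaces the sum by a product, whose
    logarithm splits.\<close>
  moreover have "Z (x + y) * Z (x - y) \<le> ((Z (x + y) + Z (x - y)) / 2)\<^sup>2"
    using sum_squares_ge_zero[of "Z (x + y) - Z (x - y)" 0]
    by (simp add: power2_eq_square field_simps)
  ultimately have "ln (Z (x + y) * Z (x - y)) \<le> ln ((exp b * Z x)\<^sup>2)"
    by (subst ln_le_cancel_iff) (intro mult_pos_pos zero_less_power pos exp_gt_zero | linarith)+
  then have 1: "ln (Z (x + y)) + ln (Z (x - y)) \<le> 2 * ln (Z x) + 2 * b"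
    using pos pos[THEN less_imp_neq, THEN not_sym]
    by (simp add: ln_mult ln_realpow power2_eq_square)
  \<comment> \<open>The added terms cancel in total, since \<tau> is the mean of the increments
    under the weights exp (x_i), exp (-x_i) divided by \<open>Z x\<close>. Applying 1 + u \<le> exp
    u termwise then gives the tangent-line bound for the convex function ln Z at x - y, without any
    differentiation.\<close>
  have "Z x = (\<Sum>i\<in>UNIV. exp (x $ i) * (1 - y $ i + \<tau>) + exp (- x $ i) * (1 + y $ i + \<tau>))"
  proof -
    have "(\<Sum>i\<in>UNIV. exp (x $ i) * (1 - y $ i + \<tau>) + exp (- x $ i) * (1 + y $ i + \<tau>))
        = (\<Sum>i\<in>UNIV. (1 + \<tau>) * (2 * cosh (x $ i)) - 2 * sinh (x $ i) * y $ i)"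
      by (intro sum.cong) (auto simp: cosh_def sinh_def field_simps)
    also have "\<dots> = (1 + \<tau>) * Z x - \<tau> * Z x"
      unfolding \<tau> by (simp add: sum_subtractf Z_def flip: sum_distrib_left)
    finally show ?thesis by (simp add: algebra_simps)
  qed
  also have "\<dots> \<le> (\<Sum>i\<in>UNIV. exp (x $ i) * exp (- y $ i + \<tau>) + exp (- x $ i) * exp (y $ i + \<tau>))"
  proof (intro sum_mono add_mono mult_left_mono)
    fix i
    show "1 - y $ i + \<tau> \<le> exp (- y $ i + \<tau>)" "1 + y $ i + \<tau> \<le> exp (y $ i + \<tau>)"
      using exp_ge_add_one_self[of "- y $ i + \<tau>"] exp_ge_add_one_self[of "y $ i + \<tau>"]
      by linarith+
  qed auto
  also have "\<dots> = exp \<tau> * Z (x - y)"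
    unfolding Z_def sum_distrib_left
    by (intro sum.cong) (auto simp: cosh_def exp_add exp_diff exp_minus field_simps)
  finally have "ln (Z x) \<le> ln (exp \<tau> * Z (x - y))"
    using pos by (subst ln_le_cancel_iff) auto
  then have "ln (Z x) \<le> \<tau> + ln (Z (x - y))"
    using pos[of "x - y"] by (simp add: ln_mult)
  with 1 show ?thesis by (simp add: \<tau>_def b_def)
qed

lemma soft_infnorm_add_le:
  fixes x y :: "real ^ 'd"
  assumes "0 < \<mu>"
  shows "soft_infnorm \<mu> (x + y) \<le> soft_infnorm \<mu> x + soft_sign \<mu> x \<bullet> y + 2 * (infnorm y)\<^sup>2 / \<mu>"
proof -
  let ?u = "(1 / \<mu>) *\<^sub>R x" and ?v = "(1 / \<mu>) *\<^sub>R y"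
  have "soft_infnorm \<mu> (x + y) = \<mu> * ln (\<Sum>i\<in>UNIV. 2 * cosh ((?u + ?v) $ i))"
    by (simp add: soft_infnorm_def add_divide_distrib)
  also have "\<dots> \<le> \<mu> * (ln (\<Sum>i\<in>UNIV. 2 * cosh (?u $ i)) + soft_sign 1 ?u \<bullet> ?v + 2 * (infnorm ?v)\<^sup>2)"
    using assms by (intro mult_left_mono ln_sum_cosh_add_le) auto
  also have "\<dots> = soft_infnorm \<mu> x + soft_sign \<mu> x \<bullet> y + 2 * (infnorm y)\<^sup>2 / \<mu>"
    using assms
    by (simp add: soft_infnorm_def soft_sign_def infnorm_mul power2_eq_square field_simps)
  finally show ?thesis .
qed

section \<open>Moment bounds in the max-norm and expected growth of the majorant\<close>

lemma borel_measurable_infnorm [measurable]: "infnorm \<in> borel_measurable borel"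
  by (intro borel_measurable_continuous_onI continuous_on_infnorm continuous_on_id)

lemma borel_measurable_soft_infnorm [measurable]: "soft_infnorm \<mu> \<in> borel_measurable borel"
  by (intro borel_measurable_continuous_onI continuous_on_soft_infnorm)

lemma integrable_of_nn_integral_le:
  fixes f :: "'a \<Rightarrow> real"
  assumes "f \<in> borel_measurable N" "\<And>z. 0 \<le> f z" "(\<integral>\<^sup>+z. ennreal (f z) \<partial>N) \<le> ennreal B" "0 \<le> B"
  shows "integrable N f" "(\<integral>z. f z \<partial>N) \<le> B"
proof -
  show *: "integrable N f"
    using assms by (intro integrableI_nonneg) (auto intro: le_less_trans)
  have "ennreal (\<integral>z. f z \<partial>N) \<le> ennreal B"
    using assms nn_integral_eq_integral[OF *] by simp
  then show "(\<integral>z. f z \<partial>N) \<le> B" using assms by (simp add: ennreal_le_iff)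
qed

text \<open>Jensen's inequality in each coordinate, in the form that a variance is
  nonnegative.\<close>

lemma (in prob_space) infnorm_expectation_le:
  fixes \<xi> :: "'a \<Rightarrow> real ^ 'd"
  assumes \<xi>: "has_bochner_integral M \<xi> e"
    and B: "(\<integral>\<^sup>+z. ennreal ((infnorm (\<xi> z))\<^sup>2) \<partial>M) \<le> ennreal (b\<^sup>2)" "0 \<le> b"
  shows "infnorm e \<le> b"
  unfolding infnorm_le_iff_cart
proof
  fix i
  have [measurable]: "\<xi> \<in> borel_measurable M" using \<xi> by (auto simp: has_bochner_integral_iff)
  have int: "integrable M (\<lambda>z. \<xi> z $ i)" and ei: "e $ i = (\<integral>z. \<xi> z $ i \<partial>M)"
    using has_bochner_integral_bounded_linear[OF bounded_linear_vec_nth \<xi>]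
    by (auto simp: has_bochner_integral_iff)
  note sq = integrable_of_nn_integral_le[OF _ _ B(1)]
  have int2: "integrable M (\<lambda>z. (infnorm (\<xi> z))\<^sup>2)" by (rule sq) auto
  have sq_le: "(\<xi> z $ i)\<^sup>2 \<le> (infnorm (\<xi> z))\<^sup>2" for z
    using component_le_infnorm_cart[of "\<xi> z" i]
    by (simp add: abs_le_square_iff[symmetric] real_abs_infnorm)
  have int3: "integrable M (\<lambda>z. (\<xi> z $ i)\<^sup>2)"
    by (rule Bochner_Integration.integrable_bound[OF int2]) (use int sq_le in auto)
  have "(e $ i)\<^sup>2 \<le> (\<integral>z. (\<xi> z $ i)\<^sup>2 \<partial>M)"
    using variance_eq[OF int int3] variance_positive[of "\<lambda>z. \<xi> z $ i"] by (simp add: ei)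
  also have "\<dots> \<le> (\<integral>z. (infnorm (\<xi> z))\<^sup>2 \<partial>M)"
    by (intro integral_mono int3 int2 sq_le)
  also have "\<dots> \<le> b\<^sup>2" by (rule sq) auto
  finally show "\<bar>e $ i\<bar> \<le> b" using B(2) by (simp add: abs_le_square_iff[symmetric])
qed

text \<open>The Euclidean fact that centering decreases the second moment fails to carry over to the
  max-norm. The triangle inequality together with (a + b)^2 \<le> 2 a^2 + 2 b^2 gives the factor
  4.\<close>

lemma (in prob_space) infnorm_centered_second_moment_le:
  fixes \<xi> :: "'a \<Rightarrow> real ^ 'd"
  assumes \<xi>: "has_bochner_integral M \<xi> e"
    and B: "(\<integral>\<^sup>+z. ennreal ((infnorm (\<xi> z))\<^sup>2) \<partial>M) \<le> ennreal (b\<^sup>2)" "0 \<le> b"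
  shows "(\<integral>\<^sup>+z. ennreal ((infnorm (\<xi> z - e))\<^sup>2) \<partial>M) \<le> ennreal (4 * b\<^sup>2)"
proof -
  have [measurable]: "\<xi> \<in> borel_measurable M" using \<xi> by (auto simp: has_bochner_integral_iff)
  have e: "infnorm e \<le> b" by (rule infnorm_expectation_le[OF assms])
  have "(infnorm (\<xi> z - e))\<^sup>2 \<le> 2 * (infnorm (\<xi> z))\<^sup>2 + 2 * b\<^sup>2" for z
  proof -
    have "infnorm (\<xi> z - e) \<le> infnorm (\<xi> z) + b"
      using infnorm_triangle[of "\<xi> z" "- e"] e by (simp add: infnorm_neg)
    then have "(infnorm (\<xi> z - e))\<^sup>2 \<le> (infnorm (\<xi> z) + b)\<^sup>2"
      by (intro power_mono infnorm_pos_le)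
    also have "\<dots> \<le> 2 * (infnorm (\<xi> z))\<^sup>2 + 2 * b\<^sup>2"
      using sum_squares_ge_zero[of "infnorm (\<xi> z) - b" 0] by (simp add: power2_eq_square algebra_simps)
    finally show ?thesis .
  qed
  then have "(\<integral>\<^sup>+z. ennreal ((infnorm (\<xi> z - e))\<^sup>2) \<partial>M)
      \<le> (\<integral>\<^sup>+z. 2 * ennreal ((infnorm (\<xi> z))\<^sup>2) + ennreal (2 * b\<^sup>2) \<partial>M)"
  proof (intro nn_integral_mono)
    fix z
    have "ennreal ((infnorm (\<xi> z - e))\<^sup>2) \<le> ennreal (2 * (infnorm (\<xi> z))\<^sup>2 + 2 * b\<^sup>2)"
      by (intro ennreal_leI) fact
    also have "\<dots> = 2 * ennreal ((infnorm (\<xi> z))\<^sup>2) + ennreal (2 * b\<^sup>2)"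
      by (subst ennreal_plus) (auto simp: ennreal_mult')
    finally show "ennreal ((infnorm (\<xi> z - e))\<^sup>2) \<le> 2 * ennreal ((infnorm (\<xi> z))\<^sup>2) + ennreal (2 * b\<^sup>2)" .
  qed
  also have "\<dots> = 2 * (\<integral>\<^sup>+z. ennreal ((infnorm (\<xi> z))\<^sup>2) \<partial>M) + ennreal (2 * b\<^sup>2)"
    by (subst nn_integral_add) (auto simp: nn_integral_cmult emeasure_space_1)
  also have "\<dots> \<le> 2 * ennreal (b\<^sup>2) + ennreal (2 * b\<^sup>2)"
    by (intro add_mono mult_left_mono B) auto
  also have "\<dots> = ennreal (4 * b\<^sup>2)"
    by (simp add: ennreal_mult' flip: distrib_right)
  finally show ?thesis .
qed

text \<open>The first-order term integrates to 0 because the increment is centered, so only the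
  quadratic term of \<open>soft_infnorm_add_le\<close> survives.\<close>

lemma (in prob_space) nn_integral_soft_infnorm_add_le:
  fixes Y :: "'a \<Rightarrow> real ^ 'd"
  assumes "0 < \<mu>" and Y: "has_bochner_integral M Y 0"
    and B: "(\<integral>\<^sup>+z. ennreal ((infnorm (Y z))\<^sup>2) \<partial>M) \<le> ennreal B" "0 \<le> B"
  shows "(\<integral>\<^sup>+z. ennreal (soft_infnorm \<mu> (a + c *\<^sub>R Y z)) \<partial>M)
    \<le> ennreal (soft_infnorm \<mu> a + 2 * c\<^sup>2 * B / \<mu>)"
proof -
  have [measurable]: "Y \<in> borel_measurable M" using Y by (auto simp: has_bochner_integral_iff)
  \<comment> \<open>The linear term has no sign, so the integral is evaluated in the reals for the
    whole of \<open>R\<close>, which is nonnegative as it lies above the majorant.\<close>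
  define R where "R z = soft_infnorm \<mu> a + (soft_sign \<mu> a \<bullet> (c *\<^sub>R Y z) + 2 * c\<^sup>2 / \<mu> * (infnorm (Y z))\<^sup>2)" for z
  note sq = integrable_of_nn_integral_le[OF _ _ B]
  have int2: "integrable M (\<lambda>z. (infnorm (Y z))\<^sup>2)" by (rule sq) auto
  have int1: "integrable M (\<lambda>z. soft_sign \<mu> a \<bullet> (c *\<^sub>R Y z))"
    using Y by (auto simp: has_bochner_integral_iff)
  have le: "soft_infnorm \<mu> (a + c *\<^sub>R Y z) \<le> R z" for z
    using soft_infnorm_add_le[OF assms(1), of a "c *\<^sub>R Y z"]
    by (simp add: R_def infnorm_mul power_mult_distrib)
  have "integrable M R" unfolding R_def
    by (intro Bochner_Integration.integrable_add integrable_mult_right int1 int2) auto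
  have "(\<integral>\<^sup>+z. ennreal (soft_infnorm \<mu> (a + c *\<^sub>R Y z)) \<partial>M) \<le> (\<integral>\<^sup>+z. ennreal (R z) \<partial>M)"
    by (intro nn_integral_mono ennreal_leI le)
  also have "\<dots> = ennreal (\<integral>z. R z \<partial>M)"
    by (intro nn_integral_eq_integral \<open>integrable M R\<close> AE_I2 order_trans[OF soft_infnorm_nonneg le] assms(1))
  also have "(\<integral>z. R z \<partial>M) = soft_infnorm \<mu> a + (\<integral>z. soft_sign \<mu> a \<bullet> (c *\<^sub>R Y z) \<partial>M)
      + 2 * c\<^sup>2 / \<mu> * (\<integral>z. (infnorm (Y z))\<^sup>2 \<partial>M)"
    unfolding R_def using int1 int2 by (simp add: prob_space)
  also have "(\<integral>z. soft_sign \<mu> a \<bullet> (c *\<^sub>R Y z) \<partial>M) = 0"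
    using Y by (simp add: has_bochner_integral_iff)
  also have "soft_infnorm \<mu> a + 0 + 2 * c\<^sup>2 / \<mu> * (\<integral>z. (infnorm (Y z))\<^sup>2 \<partial>M)
      \<le> soft_infnorm \<mu> a + 0 + 2 * c\<^sup>2 / \<mu> * B"
    using assms(1) by (intro add_mono mult_left_mono sq) auto
  finally show ?thesis by (simp add: ennreal_leI)
qed

text \<open>By Tonelli the newest coordinate is integrated innermost, with the sum of the others
  absorbed into the base point. Every coordinate costs the same, so the bound is linear in
  \<open>card I\<close>; for an average, c = 1 / card I leaves one factor 1 / card I.\<close>

lemma (in prob_space) nn_integral_soft_infnorm_sum_le:
  fixes Y :: "'a \<Rightarrow> real ^ 'd"
  assumes "0 < \<mu>" and Y: "has_bochner_integral M Y 0"
    and B: "(\<integral>\<^sup>+z. ennreal ((infnorm (Y z))\<^sup>2) \<partial>M) \<le> ennreal B" "0 \<le> B"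
    and "finite I"
  shows "(\<integral>\<^sup>+z. ennreal (soft_infnorm \<mu> (a + c *\<^sub>R (\<Sum>i\<in>I. Y (z i)))) \<partial>Pi\<^sub>M I (\<lambda>_. M))
    \<le> ennreal (soft_infnorm \<mu> a + real (card I) * (2 * c\<^sup>2 * B / \<mu>))"
  using \<open>finite I\<close>
proof (induction I)
  case empty
  interpret PI: prob_space "Pi\<^sub>M {} (\<lambda>_. M)" by (intro prob_space_PiM prob_space_axioms)
  show ?case by (simp add: PI.emeasure_space_1)
next
  case (insert j I)
  interpret P: product_prob_space "\<lambda>_. M" "I" ..
  have PI: "emeasure (Pi\<^sub>M I (\<lambda>_. M)) (space (Pi\<^sub>M I (\<lambda>_. M))) = 1"
    by (intro prob_space.emeasure_space_1 prob_space_PiM prob_space_axioms)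
  have [measurable]: "Y \<in> borel_measurable M" using Y by (auto simp: has_bochner_integral_iff)
  define \<beta> where "\<beta> = 2 * c\<^sup>2 * B / \<mu>"
  have "0 \<le> \<beta>" using assms by (simp add: \<beta>_def)
  have "(\<integral>\<^sup>+z. ennreal (soft_infnorm \<mu> (a + c *\<^sub>R (\<Sum>i\<in>insert j I. Y (z i)))) \<partial>Pi\<^sub>M (insert j I) (\<lambda>_. M))
    = (\<integral>\<^sup>+x. (\<integral>\<^sup>+y. ennreal (soft_infnorm \<mu> (a + c *\<^sub>R (\<Sum>i\<in>insert j I. Y ((x(j := y)) i)))) \<partial>M) \<partial>Pi\<^sub>M I (\<lambda>_. M))"
    by (intro P.product_nn_integral_insert insert.hyps) measurable
  also have "\<dots> = (\<integral>\<^sup>+x. (\<integral>\<^sup>+y. ennreal (soft_infnorm \<mu> ((a + c *\<^sub>R (\<Sum>i\<in>I. Y (x i))) + c *\<^sub>R Y y)) \<partial>M) \<partial>Pi\<^sub>M I (\<lambda>_. M))"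
  proof (intro nn_integral_cong)
    fix x y
    have "(\<Sum>i\<in>insert j I. Y ((x(j := y)) i)) = Y y + (\<Sum>i\<in>I. Y (x i))"
      using insert.hyps by (auto intro!: sum.cong arg_cong2[where f="(+)"])
    then show "ennreal (soft_infnorm \<mu> (a + c *\<^sub>R (\<Sum>i\<in>insert j I. Y ((x(j := y)) i))))
      = ennreal (soft_infnorm \<mu> ((a + c *\<^sub>R (\<Sum>i\<in>I. Y (x i))) + c *\<^sub>R Y y))"
      by (simp add: algebra_simps)
  qed
  also have "\<dots> \<le> (\<integral>\<^sup>+x. ennreal (soft_infnorm \<mu> (a + c *\<^sub>R (\<Sum>i\<in>I. Y (x i))) + \<beta>) \<partial>Pi\<^sub>M I (\<lambda>_. M))"
    unfolding \<beta>_def by (intro nn_integral_mono nn_integral_soft_infnorm_add_le assms)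
  also have "\<dots> = (\<integral>\<^sup>+x. ennreal (soft_infnorm \<mu> (a + c *\<^sub>R (\<Sum>i\<in>I. Y (x i)))) + ennreal \<beta> \<partial>Pi\<^sub>M I (\<lambda>_. M))"
    using \<open>0 \<le> \<beta>\<close> assms(1) by (simp add: soft_infnorm_nonneg)
  also have "\<dots> = (\<integral>\<^sup>+x. ennreal (soft_infnorm \<mu> (a + c *\<^sub>R (\<Sum>i\<in>I. Y (x i)))) \<partial>Pi\<^sub>M I (\<lambda>_. M)) + ennreal \<beta>"
    by (subst nn_integral_add) (auto simp: PI)
  also have "\<dots> \<le> ennreal (soft_infnorm \<mu> a + real (card I) * \<beta>) + ennreal \<beta>"
    unfolding \<beta>_def by (intro add_right_mono insert.IH)
  also have "\<dots> = ennreal (soft_infnorm \<mu> a + real (card (insert j I)) * \<beta>)"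
    using \<open>0 \<le> \<beta>\<close> assms(1) insert.hyps soft_infnorm_nonneg[of \<mu> a]
    by (subst ennreal_plus[symmetric]) (auto simp: algebra_simps)
  finally show ?case unfolding \<beta>_def .
qed

section \<open>The proximal step on an l1-ball\<close>

lemma convex_l1_ball:
  fixes a :: "real ^ 'd"
  shows "convex {z. l1_norm (z - a) \<le> r}"
  unfolding convex_alt
proof clarsimp
  fix x y :: "real ^ 'd" and u :: real
  assume h: "l1_norm (x - a) \<le> r" "l1_norm (y - a) \<le> r" "0 \<le> u" "u \<le> 1"
  have "(1 - u) *\<^sub>R x + u *\<^sub>R y - a = (1 - u) *\<^sub>R (x - a) + u *\<^sub>R (y - a)"
    by (simp add: algebra_simps)
  then have "l1_norm ((1 - u) *\<^sub>R x + u *\<^sub>R y - a)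
      \<le> l1_norm ((1 - u) *\<^sub>R (x - a)) + l1_norm (u *\<^sub>R (y - a))"
    using l1_norm_triangle by metis
  also have "\<dots> \<le> (1 - u) * r + u * r"
    unfolding l1_norm_scaleR using h by (intro add_mono mult_mono) (auto simp: l1_norm_nonneg)
  finally show "l1_norm ((1 - u) *\<^sub>R x + u *\<^sub>R y - a) \<le> r" by (simp add: algebra_simps)
qed

lemma closed_l1_ball: "closed {z. l1_norm (z - a) \<le> r}"
  by (intro closed_Collect_le continuous_intros)

text \<open>The multiplier of the constraint \<open>l1_norm (y - x) \<le> \<psi>\<close> is eliminated by moving from \<open>x'\<close> towards
  \<open>y\<close> and, just enough to stay in the ball, back towards \<open>x\<close>.\<close>

lemma prox_step_l1_ball:
  fixes X :: "(real ^ 'd) set"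
  assumes X: "closed X" "convex X" "x \<in> X" and "0 < \<psi>"
    and step: "is_arg_min
        (\<lambda>y. ereal (1 / 2 * (norm (y - (x - \<eta> *\<^sub>R G)))\<^sup>2) + ind_fun {z. l1_norm z \<le> \<psi>} (y - x))
        (\<lambda>y. y \<in> X) x'"
  shows "x' \<in> X" "l1_norm (x' - x) \<le> \<psi>"
    "(x' - x + \<eta> *\<^sub>R G) \<bullet> (x' - x) \<le> 0"
    "\<And>y. y \<in> X \<Longrightarrow> l1_norm (y - x') / \<psi> * ((x' - x + \<eta> *\<^sub>R G) \<bullet> (x' - x)) \<le> (x' - x + \<eta> *\<^sub>R G) \<bullet> (y - x')"
proof -
  define q where "q y = ereal (1 / 2 * (norm (y - (x - \<eta> *\<^sub>R G)))\<^sup>2) + ind_fun {z. l1_norm z \<le> \<psi>} (y - x)" for y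
  have x'X: "x' \<in> X" and min: "q x' \<le> q y" if "y \<in> X" for y
    using step that unfolding is_arg_min_def q_def[abs_def] by (auto simp: not_less)
  show "x' \<in> X" using step by (simp add: is_arg_min_def)
  \<comment> \<open>The current point is feasible, so the minimum is finite and the minimiser
    respects the l1-constraint.\<close>
  have "q x < \<infinity>" using \<open>0 < \<psi>\<close> by (simp add: q_def ind_fun_def)
  then have "q x' < \<infinity>" using min[OF X(3)] by (rule le_less_trans[rotated])
  then show s: "l1_norm (x' - x) \<le> \<psi>" by (simp add: q_def ind_fun_def split: if_splits)
  define C where "C = X \<inter> {z. l1_norm (z - x) \<le> \<psi>}"
  define g where "g = x' - x + \<eta> *\<^sub>R G"
  have C: "convex C" "closed C"
    unfolding C_def using X by (auto intro!: convex_Int closed_Int convex_l1_ball closed_l1_ball)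
  \<comment> \<open>On \<open>C\<close> the objective is a squared Euclidean distance, so
    \<open>x'\<close> is a projection and the obtuse-angle criterion applies.\<close>
  have VI: "0 \<le> g \<bullet> (z - x')" if "z \<in> C" for z
  proof -
    have "dist (x - \<eta> *\<^sub>R G) x' \<le> dist (x - \<eta> *\<^sub>R G) w" if "w \<in> C" for w
    proof -
      have "q x' \<le> q w" using min that by (simp add: C_def)
      then have "(norm (x' - (x - \<eta> *\<^sub>R G)))\<^sup>2 \<le> (norm (w - (x - \<eta> *\<^sub>R G)))\<^sup>2"
        using s that by (simp add: q_def ind_fun_def C_def)
      then show ?thesis by (simp add: dist_norm norm_minus_commute abs_le_square_iff[symmetric])
    qed
    then have "(x - \<eta> *\<^sub>R G - x') \<bullet> (z - x') \<le> 0"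
      using any_closest_point_dot[OF C, of x' z "x - \<eta> *\<^sub>R G"] that s \<open>x' \<in> X\<close> by (auto simp: C_def)
    moreover have "x - \<eta> *\<^sub>R G - x' = - g" by (simp add: g_def)
    ultimately show ?thesis by simp
  qed
  have "x \<in> C" using X \<open>0 < \<psi>\<close> by (simp add: C_def)
  from VI[OF this] have gs: "g \<bullet> (x' - x) \<le> 0" by (simp add: inner_diff_right)
  then show "(x' - x + \<eta> *\<^sub>R G) \<bullet> (x' - x) \<le> 0" by (simp add: g_def)
  fix y assume "y \<in> X"
  define l where "l = l1_norm (y - x')"
  \<comment> \<open>The weights sum to 1 and satisfy \<tau> l = \<rho> \<psi>. Hence
    \<open>z\<close> is a convex combination of points of \<open>X\<close>, and the l1-length gained
    towards \<open>y\<close>, at most \<tau> l, equals the \<rho> \<psi> released by shrinking the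
    old step.\<close>
  define \<tau> where "\<tau> = \<psi> / (\<psi> + l)"
  define \<rho> where "\<rho> = l / (\<psi> + l)"
  have l0: "0 \<le> l" by (simp add: l_def l1_norm_nonneg)
  have \<tau>: "0 < \<tau>" "0 \<le> \<rho>" "\<tau> + \<rho> = 1" "\<tau> * l = \<rho> * \<psi>"
    using l0 \<open>0 < \<psi>\<close> by (auto simp: \<tau>_def \<rho>_def add_divide_distrib[symmetric])
  define z where "z = \<tau> *\<^sub>R y + \<rho> *\<^sub>R x"
  have \<tau>_eq: "\<tau> = 1 - \<rho>" using \<tau> by simp
  have zX: "z \<in> X"
    unfolding z_def using convexD[OF X(2) \<open>y \<in> X\<close> X(3)] \<tau> by simp
  have "z - x = \<tau> *\<^sub>R (y - x') + (1 - \<rho>) *\<^sub>R (x' - x)"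
    unfolding z_def \<tau>_eq by (simp add: algebra_simps)
  then have "l1_norm (z - x) \<le> l1_norm (\<tau> *\<^sub>R (y - x')) + l1_norm ((1 - \<rho>) *\<^sub>R (x' - x))"
    using l1_norm_triangle by metis
  then have "l1_norm (z - x) \<le> \<tau> * l + (1 - \<rho>) * l1_norm (x' - x)"
    unfolding l1_norm_scaleR l_def[symmetric] using \<tau> by simp
  moreover have "(1 - \<rho>) * l1_norm (x' - x) \<le> (1 - \<rho>) * \<psi>"
    using \<tau> by (intro mult_left_mono s) simp
  ultimately have "l1_norm (z - x) \<le> \<rho> * \<psi> + (1 - \<rho>) * \<psi>" unfolding \<tau>(4) by linarith
  then have "l1_norm (z - x) \<le> \<psi>" by (simp add: algebra_simps)
  with zX have "0 \<le> g \<bullet> (z - x')" by (intro VI) (simp add: C_def)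
  moreover have "z - x' = \<tau> *\<^sub>R (y - x') - \<rho> *\<^sub>R (x' - x)"
    unfolding z_def \<tau>_eq by (simp add: algebra_simps)
  ultimately have "\<rho> * (g \<bullet> (x' - x)) \<le> \<tau> * (g \<bullet> (y - x'))"
    by (simp add: inner_diff_right)
  then have "\<rho> / \<tau> * (g \<bullet> (x' - x)) \<le> g \<bullet> (y - x')" using \<tau> by (simp add: field_simps)
  moreover have "\<rho> / \<tau> = l / \<psi>" using \<tau> \<open>0 < \<psi>\<close> by (simp add: field_simps)
  ultimately show "l1_norm (y - x') / \<psi> * ((x' - x + \<eta> *\<^sub>R G) \<bullet> (x' - x)) \<le> (x' - x + \<eta> *\<^sub>R G) \<bullet> (y - x')"
    by (simp add: g_def l_def)
qed

section \<open>Regularity of the objective and the residual after one step\<close>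

context stochastic_problem
begin

text \<open>Mean-square smoothness passes to the expected gradient by Jensen's inequality, with the
  same constant.\<close>

lemma infnorm_grad_diff_le:
  assumes "x \<in> X" "y \<in> X"
  shows "infnorm (grad (objective D F) x - grad (objective D F) y) \<le> L * l1_norm (x - y)"
proof (rule prob_space.infnorm_expectation_le[OF D_prob])
  show "has_bochner_integral D (\<lambda>z. stoch_grad F x z - stoch_grad F y z)
      (grad (objective D F) x - grad (objective D F) y)"
    by (intro has_bochner_integral_diff unbiased assms)
  show "(\<integral>\<^sup>+z. ennreal ((infnorm (stoch_grad F x z - stoch_grad F y z))\<^sup>2) \<partial>D)
      \<le> ennreal ((L * l1_norm (x - y))\<^sup>2)"
    using mean_square_smooth[OF assms] by (simp add: power_mult_distrib)
  show "0 \<le> L * l1_norm (x - y)" using L_nonneg by (simp add: l1_norm_nonneg)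
qed

text \<open>The Lipschitz bound is between the l1-norm and the max-norm; returning to the Euclidean
  norm costs a factor depending on the dimension, which is harmless for continuity.\<close>

lemma continuous_on_grad: "continuous_on X (grad (objective D F))"
  unfolding continuous_on_def
proof
  fix x assume "x \<in> X"
  define B where "B y = sqrt (real DIM(real ^ 'd)) * (L * l1_norm (y - x))" for y :: "real ^ 'd"
  have "continuous_on UNIV B" unfolding B_def[abs_def] by (intro continuous_intros)
  then have "isCont B x" by (simp add: continuous_on_eq_continuous_at)
  then have "(B \<longlongrightarrow> 0) (at x within X)"
    by (auto simp: isCont_def B_def intro: tendsto_within_subset)
  moreover have "\<forall>\<^sub>F y in at x within X. norm (grad (objective D F) y - grad (objective D F) x) \<le> B y"
  proof (rule eventually_at_filter[THEN iffD2], intro always_eventually allI impI)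
    fix y assume "y \<in> X"
    have "norm (grad (objective D F) y - grad (objective D F) x)
       \<le> sqrt (real DIM(real ^ 'd)) * infnorm (grad (objective D F) y - grad (objective D F) x)"
      by (rule norm_le_infnorm)
    also have "\<dots> \<le> B y"
      unfolding B_def by (intro mult_left_mono infnorm_grad_diff_le \<open>x \<in> X\<close> \<open>y \<in> X\<close>) simp
    finally show "norm (grad (objective D F) y - grad (objective D F) x) \<le> B y" .
  qed
  ultimately have "((\<lambda>y. grad (objective D F) y - grad (objective D F) x) \<longlongrightarrow> 0) (at x within X)"
    by (rule Lim_null_comparison[rotated])
  then show "(grad (objective D F) \<longlongrightarrow> grad (objective D F) x) (at x within X)"
    by (simp add: LIM_zero_iff)
qed

text \<open>The mean value theorem gives one intermediate point, which lies in \<open>X\<close> by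
  convexity and where the Lipschitz bound is used. Compared with integrating the gradient along the
  segment this gives L where L / 2 would be possible.\<close>

lemma objective_le_quadratic:
  assumes "x \<in> X" "y \<in> X"
  shows "objective D F y \<le> objective D F x + grad (objective D F) x \<bullet> (y - x) + L * (l1_norm (y - x))\<^sup>2"
proof -
  define s where "s = y - x"
  define h where "h t = objective D F (x + t *\<^sub>R s)" for t
  have "\<exists>t. 0 < t \<and> t < 1 \<and> h 1 - h 0 = (1 - 0) * (grad (objective D F) (x + t *\<^sub>R s) \<bullet> s)"
  proof (rule MVT2)
    fix t :: real
    have "(objective D F has_derivative (\<lambda>h. h \<bullet> grad (objective D F) (x + t *\<^sub>R s))) (at (x + t *\<^sub>R s))"
      using gderiv_grad[OF f_differentiable] by (simp add: gderiv_def)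
    moreover have "((\<lambda>t. x + t *\<^sub>R s) has_derivative (\<lambda>u. u *\<^sub>R s)) (at t)"
      by (auto intro!: derivative_eq_intros)
    ultimately have "(h has_derivative (\<lambda>u. (u *\<^sub>R s) \<bullet> grad (objective D F) (x + t *\<^sub>R s))) (at t)"
      unfolding h_def[abs_def] by (rule has_derivative_compose[rotated])
    then show "(h has_real_derivative grad (objective D F) (x + t *\<^sub>R s) \<bullet> s) (at t)"
      unfolding has_field_derivative_def by (simp add: inner_commute mult_commute_abs)
  qed simp
  then obtain t where t: "0 < t" "t < 1" "objective D F y - objective D F x = grad (objective D F) (x + t *\<^sub>R s) \<bullet> s"
    by (auto simp: h_def s_def)
  have "x + t *\<^sub>R s = (1 - t) *\<^sub>R x + t *\<^sub>R y" by (simp add: s_def algebra_simps)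
  then have "x + t *\<^sub>R s \<in> X" using X_convex assms t by (simp add: convex_alt)
  then have "infnorm (grad (objective D F) (x + t *\<^sub>R s) - grad (objective D F) x) \<le> L * (t * l1_norm s)"
    using infnorm_grad_diff_le[of "x + t *\<^sub>R s" x] assms t by (simp add: l1_norm_scaleR)
  also have "\<dots> \<le> L * (1 * l1_norm s)"
    using t L_nonneg by (intro mult_left_mono mult_right_mono) (auto simp: l1_norm_nonneg)
  finally have "infnorm (grad (objective D F) (x + t *\<^sub>R s) - grad (objective D F) x) * l1_norm s \<le> L * l1_norm s * l1_norm s"
    by (intro mult_right_mono) (auto simp: l1_norm_nonneg)
  then have "(grad (objective D F) (x + t *\<^sub>R s) - grad (objective D F) x) \<bullet> s \<le> L * (l1_norm s)\<^sup>2"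
    using inner_le_infnorm_l1_norm[of "grad (objective D F) (x + t *\<^sub>R s) - grad (objective D F) x" s]
    by (simp add: power2_eq_square)
  then show ?thesis using t(3) by (simp add: inner_diff_left s_def)
qed

text \<open>The new gradient is split as (grad f x' - grad f x) + (grad f x - G) - L s + (L s + G).
  The first three parts contribute L \<psi>, the error E and L \<psi>. The last is controlled by
  optimality of the step, whose multiplier is at most (f x - f x') / \<psi> + L \<psi> + E by the
  quadratic upper bound. Nonnegativity of \<open>c\<close> is part of the claim because f may
  increase.\<close>

lemma l1_residual_step_le:
  assumes "x \<in> X" "0 < \<psi>" "0 < L"
    and step: "is_arg_min
        (\<lambda>y. ereal (1 / 2 * (norm (y - (x - (1 / L) *\<^sub>R G)))\<^sup>2) + ind_fun {z. l1_norm z \<le> \<psi>} (y - x))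
        (\<lambda>y. y \<in> X) x'"
  defines "c \<equiv> 3 * L * \<psi> + 2 * infnorm (G - grad (objective D F) x)
      + (objective D F x - objective D F x') / \<psi>"
  shows "0 \<le> c" "l1_residual (objective D F) X x' \<le> ennreal c"
proof -
  note prox = prox_step_l1_ball[OF X_closed X_convex \<open>x \<in> X\<close> \<open>0 < \<psi>\<close> step]
  define s where "s = x' - x"
  define f where "f = objective D F"
  define E where "E = infnorm (G - grad f x)"
  define p where "p = (s + (1 / L) *\<^sub>R G) \<bullet> s"
  have s_le: "l1_norm s \<le> \<psi>" and p_le: "p \<le> 0" using prox by (simp_all add: s_def p_def)
  have s0: "0 \<le> l1_norm s" and E0: "0 \<le> E"
    by (simp_all add: l1_norm_nonneg E_def infnorm_pos_le)
  have Lp: "L * p = L * (s \<bullet> s) + G \<bullet> s"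
    using \<open>0 < L\<close> by (simp add: p_def inner_add_left field_simps)
  have "f x' \<le> f x + grad f x \<bullet> s + L * (l1_norm s)\<^sup>2"
    using objective_le_quadratic[OF \<open>x \<in> X\<close> prox(1)] by (simp add: f_def s_def)
  moreover have "L * (l1_norm s)\<^sup>2 \<le> L * \<psi>\<^sup>2"
    using s_le s0 \<open>0 < L\<close> by (intro mult_left_mono power_mono) auto
  moreover have "- (G - grad f x) \<bullet> s \<le> E * \<psi>"
  proof -
    have "- (G - grad f x) \<bullet> s \<le> E * l1_norm s"
      using inner_le_infnorm_l1_norm[of "G - grad f x" s]
      unfolding E_def inner_minus_left by linarith
    also have "\<dots> \<le> E * \<psi>" using s_le E0 by (intro mult_left_mono)
    finally show ?thesis .
  qed
  moreover have "0 \<le> L * (s \<bullet> s)" using \<open>0 < L\<close> by simp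
  ultimately have "f x' - f x - L * \<psi>\<^sup>2 - E * \<psi> \<le> L * p"
    unfolding Lp by (simp add: inner_diff_left)
  then have "(f x' - f x - L * \<psi>\<^sup>2 - E * \<psi>) / \<psi> \<le> L * p / \<psi>"
    using \<open>0 < \<psi>\<close> by (intro divide_right_mono) auto
  then have key: "- ((f x - f x') / \<psi> + L * \<psi> + E) \<le> L * p / \<psi>"
    using \<open>0 < \<psi>\<close> by (simp add: diff_divide_distrib power2_eq_square)
  have c_eq: "c = 3 * L * \<psi> + 2 * E + (f x - f x') / \<psi>" by (simp add: c_def E_def f_def)
  have "L * p / \<psi> \<le> 0"
    using p_le \<open>0 < L\<close> \<open>0 < \<psi>\<close> by (simp add: divide_nonpos_pos mult_nonneg_nonpos)
  moreover have "0 \<le> L * \<psi>" using \<open>0 < L\<close> \<open>0 < \<psi>\<close> by simp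
  \<comment> \<open>Since \<open>L * p / \<psi>\<close> is nonpositive, \<open>key\<close> bounds a
    possible increase of f, divided by \<psi>, by L \<psi> + E.\<close>
  ultimately show "0 \<le> c" using key E0 unfolding c_eq by linarith
  show "l1_residual (objective D F) X x' \<le> ennreal c"
    unfolding l1_residual_le_iff[OF \<open>0 \<le> c\<close>] f_def[symmetric]
  proof
    fix y assume "y \<in> X"
    define d where "d = y - x'"
    define l where "l = l1_norm d"
    have l0: "0 \<le> l" by (simp add: l_def l1_norm_nonneg)
    have hold: "- (b * l) \<le> v \<bullet> d" if "infnorm v \<le> b" for v b
      using inner_le_infnorm_l1_norm[of v d] mult_right_mono[OF that l0] by (simp add: l_def abs_le_iff)
    have "infnorm (grad f x' - grad f x) \<le> L * \<psi>"
    proof -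
      have "infnorm (grad f x' - grad f x) \<le> L * l1_norm s"
        unfolding f_def s_def by (rule infnorm_grad_diff_le[OF prox(1) \<open>x \<in> X\<close>])
      also have "\<dots> \<le> L * \<psi>" using s_le \<open>0 < L\<close> by (intro mult_left_mono) auto
      finally show ?thesis .
    qed
    then have 1: "- (L * \<psi> * l) \<le> (grad f x' - grad f x) \<bullet> d" by (rule hold)
    have 2: "- (E * l) \<le> (grad f x - G) \<bullet> d" by (rule hold) (simp add: E_def infnorm_sub)
    have "infnorm (- (L *\<^sub>R s)) \<le> L * \<psi>"
      using infnorm_le_l1_norm[of s] s_le \<open>0 < L\<close> by (simp add: infnorm_neg infnorm_mul)
    then have 3: "- (L * \<psi> * l) \<le> - (L *\<^sub>R s) \<bullet> d" by (rule hold)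
    have "L * (l / \<psi> * p) \<le> L * ((s + (1 / L) *\<^sub>R G) \<bullet> d)"
      using prox(4)[OF \<open>y \<in> X\<close>] \<open>0 < L\<close> by (intro mult_left_mono) (auto simp: s_def p_def d_def l_def)
    also have "\<dots> = (L *\<^sub>R s + G) \<bullet> d" using \<open>0 < L\<close> by (simp add: inner_add_left field_simps)
    finally have 4: "l * (L * p / \<psi>) \<le> (L *\<^sub>R s + G) \<bullet> d" by (simp add: mult_ac)
    have "l * - ((f x - f x') / \<psi> + L * \<psi> + E) \<le> l * (L * p / \<psi>)"
      by (intro mult_left_mono key l0)
    with 1 2 3 4 have "- (c * l) \<le> grad f x' \<bullet> d"
      unfolding c_eq by (simp add: inner_diff_left inner_add_left algebra_simps)
    then show "- (c * l1_norm (y - x')) \<le> grad f x' \<bullet> (y - x')" by (simp add: l_def d_def)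
  qed
qed

end

section \<open>Measurability and independence\<close>

text \<open>Rounding y down to a grid of mesh 1 / (n + 1) leaves countably many values, on each of
  which measurability in the second argument is enough. Continuity in y gives pointwise convergence
  as the mesh shrinks.\<close>

lemma borel_measurable_Caratheodory:
  fixes f :: "real ^ 'd \<Rightarrow> 'z \<Rightarrow> real"
  assumes meas: "\<And>y. f y \<in> borel_measurable N"
    and cont: "\<And>z. z \<in> space N \<Longrightarrow> continuous_on UNIV (\<lambda>y. f y z)"
  shows "(\<lambda>(y, z). f y z) \<in> borel_measurable (borel \<Otimes>\<^sub>M N)"
proof -
  define c where "c n v = (\<chi> i. of_int (v $ i) / real (Suc n))" for n and v :: "int ^ 'd"
  define g where "g n y = (\<chi> i. \<lfloor>real (Suc n) * y $ i\<rfloor>)" for n and y :: "real ^ 'd"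
  have g: "g n \<in> measurable borel (count_space UNIV)" for n
  proof (subst measurable_count_space_eq_countable, safe)
    fix v :: "int ^ 'd"
    have "g n -` {v} \<inter> space borel = (\<Inter>i. {y. \<lfloor>real (Suc n) * y $ i\<rfloor> = v $ i})"
      by (auto simp: g_def vec_eq_iff)
    moreover have "{y :: real ^ 'd. \<lfloor>real (Suc n) * y $ i\<rfloor> = v $ i} \<in> sets borel" for i
    proof -
      have "(\<lambda>y :: real ^ 'd. real (Suc n) * y $ i) \<in> borel_measurable borel"
        by (intro borel_measurable_continuous_onI continuous_intros)
      then have "(\<lambda>y :: real ^ 'd. \<lfloor>real (Suc n) * y $ i\<rfloor>) \<in> measurable borel (count_space UNIV)"
        by measurable
      then have "(\<lambda>y :: real ^ 'd. \<lfloor>real (Suc n) * y $ i\<rfloor>) -` {v $ i} \<inter> space borel \<in> sets borel"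
        by (rule measurable_sets) simp
      then show ?thesis by (simp add: vimage_def)
    qed
    ultimately show "g n -` {v} \<inter> space borel \<in> sets borel" by auto
  qed (auto simp: countableI_type)
  show ?thesis
  proof (rule borel_measurable_LIMSEQ_real)
    fix n
    have "(\<lambda>p :: (real ^ 'd) \<times> 'z. (\<lambda>v p. f (c n v) (snd p)) (g n (fst p)) p) \<in> borel_measurable (borel \<Otimes>\<^sub>M N)"
      by (rule measurable_compose_countable)
        (auto intro!: measurable_compose[OF measurable_snd meas] measurable_compose[OF measurable_fst g])
    then show "(\<lambda>p. f (c n (g n (fst p))) (snd p)) \<in> borel_measurable (borel \<Otimes>\<^sub>M N)" by simp
  next
    fix p :: "(real ^ 'd) \<times> 'z" assume "p \<in> space (borel \<Otimes>\<^sub>M N)"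
    then have p: "snd p \<in> space N" by (auto simp: space_pair_measure)
    have "(\<lambda>n. c n (g n (fst p)) $ i) \<longlonglongrightarrow> fst p $ i" for i
    proof (rule LIMSEQ_I)
      fix e :: real assume "0 < e"
      obtain n0 where n0: "1 / e < real n0" using reals_Archimedean2 by blast
      show "\<exists>n0. \<forall>n\<ge>n0. norm (c n (g n (fst p)) $ i - fst p $ i) < e"
      proof (intro exI allI impI)
        fix n assume "n0 \<le> n"
        define t where "t = fst p $ i"
        have "\<bar>of_int \<lfloor>real (Suc n) * t\<rfloor> - real (Suc n) * t\<bar> \<le> 1" by linarith
        then have "\<bar>of_int \<lfloor>real (Suc n) * t\<rfloor> - real (Suc n) * t\<bar> / real (Suc n) \<le> 1 / real (Suc n)"
          by (intro divide_right_mono) auto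
        moreover have "\<bar>of_int \<lfloor>real (Suc n) * t\<rfloor> - real (Suc n) * t\<bar> / real (Suc n)
            = \<bar>of_int \<lfloor>real (Suc n) * t\<rfloor> / real (Suc n) - t\<bar>"
        proof -
          have "of_int \<lfloor>real (Suc n) * t\<rfloor> / real (Suc n) - t
              = (of_int \<lfloor>real (Suc n) * t\<rfloor> - real (Suc n) * t) / real (Suc n)"
            by (simp only: diff_divide_distrib) simp
          then show ?thesis by (simp only: abs_divide)
        qed
        moreover have "1 / real (Suc n) < e"
        proof -
          have "1 / e < real (Suc n)" using n0 \<open>n0 \<le> n\<close> by linarith
          then show ?thesis using \<open>0 < e\<close> by (simp only: pos_divide_less_eq) (simp add: pos_divide_less_eq mult.commute)
        qed
        ultimately show "norm (c n (g n (fst p)) $ i - fst p $ i) < e"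
          by (simp add: c_def g_def t_def)
      qed
    qed
    then have "(\<lambda>n. c n (g n (fst p))) \<longlonglongrightarrow> fst p" by (intro vec_tendstoI)
    then show "(\<lambda>n. f (c n (g n (fst p))) (snd p)) \<longlonglongrightarrow> (case p of (y, z) \<Rightarrow> f y z)"
      using cont[OF p] unfolding case_prod_beta
      by (intro continuous_on_tendsto_compose[OF cont[OF p]]) auto
  qed
qed

text \<open>Each coordinate of the gradient is the limit of difference quotients with steps 1 / (n +
  1) along that axis. The quotients are jointly measurable because differentiability makes the
  function continuous in y.\<close>

lemma borel_measurable_stoch_grad:
  fixes f :: "real ^ 'd \<Rightarrow> 'z \<Rightarrow> real"
  assumes meas: "\<And>y. f y \<in> borel_measurable N"
    and diff: "\<And>y z. z \<in> space N \<Longrightarrow> (\<lambda>y. f y z) differentiable (at y)"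
  shows "(\<lambda>(y, z). stoch_grad f y z) \<in> borel_measurable (borel \<Otimes>\<^sub>M N)"
proof -
  have [measurable]: "(\<lambda>(y, z). f y z) \<in> borel_measurable (borel \<Otimes>\<^sub>M N)"
    by (intro borel_measurable_Caratheodory meas)
      (auto simp: diff intro!: differentiable_imp_continuous_on differentiable_at_imp_differentiable_on)
  have "(\<lambda>p. stoch_grad f (fst p) (snd p) $ i) \<in> borel_measurable (borel \<Otimes>\<^sub>M N)" for i
  proof (rule borel_measurable_LIMSEQ_real)
    fix n
    have shift: "(\<lambda>p :: (real ^ 'd) \<times> 'z. (fst p + (1 / real (Suc n)) *\<^sub>R axis i 1, snd p))
        \<in> measurable (borel \<Otimes>\<^sub>M N) (borel \<Otimes>\<^sub>M N)" by measurable
    have "(\<lambda>p. f (fst p + (1 / real (Suc n)) *\<^sub>R axis i 1) (snd p)) \<in> borel_measurable (borel \<Otimes>\<^sub>M N)"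
      using measurable_compose[OF shift, of "\<lambda>(y, z). f y z"] by simp
    moreover have "(\<lambda>p. f (fst p) (snd p)) \<in> borel_measurable (borel \<Otimes>\<^sub>M N)"
      using \<open>(\<lambda>(y, z). f y z) \<in> borel_measurable (borel \<Otimes>\<^sub>M N)\<close> by (simp add: case_prod_beta')
    ultimately show "(\<lambda>p. real (Suc n) * (f (fst p + (1 / real (Suc n)) *\<^sub>R axis i 1) (snd p) - f (fst p) (snd p)))
        \<in> borel_measurable (borel \<Otimes>\<^sub>M N)" by measurable
  next
    fix p :: "(real ^ 'd) \<times> 'z" assume "p \<in> space (borel \<Otimes>\<^sub>M N)"
    then have p: "snd p \<in> space N" by (auto simp: space_pair_measure)
    define h where "h t = f (fst p + t *\<^sub>R axis i 1) (snd p)" for t :: real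
    define G where "G = stoch_grad f (fst p) (snd p)"
    have "((\<lambda>y. f y (snd p)) has_derivative (\<lambda>h. h \<bullet> G)) (at (fst p + 0 *\<^sub>R axis i 1))"
      using gderiv_grad[OF diff[OF p]] by (simp add: gderiv_def G_def stoch_grad_def)
    moreover have "((\<lambda>t. fst p + t *\<^sub>R axis i 1) has_derivative (\<lambda>u. u *\<^sub>R axis i 1)) (at 0)"
      by (auto intro!: derivative_eq_intros)
    ultimately have "(h has_derivative (\<lambda>u. (u *\<^sub>R axis i 1) \<bullet> G)) (at 0)"
      unfolding h_def[abs_def] by (rule has_derivative_compose[rotated])
    then have "(h has_real_derivative G $ i) (at 0)"
      unfolding has_field_derivative_def by (simp add: inner_axis' mult_commute_abs)
    then have lim: "(\<lambda>t. (h t - h 0) / t) \<midarrow>0\<rightarrow> G $ i"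
      by (simp add: DERIV_def)
    have "(\<lambda>n. (h (1 / real (Suc n)) - h 0) / (1 / real (Suc n))) \<longlonglongrightarrow> G $ i"
      by (rule filterlim_compose[OF lim])
        (auto simp: filterlim_at simp del: of_nat_Suc intro!: LIMSEQ_Suc[OF lim_1_over_n])
    then show "(\<lambda>n. real (Suc n) * (f (fst p + (1 / real (Suc n)) *\<^sub>R axis i 1) (snd p) - f (fst p) (snd p)))
        \<longlonglongrightarrow> stoch_grad f (fst p) (snd p) $ i"
      by (simp add: h_def G_def mult.commute)
  qed
  then show ?thesis
    unfolding case_prod_beta'
    by (subst borel_measurable_euclidean_space) (auto simp: Basis_vec_def inner_axis)
qed

lemma borel_measurable_grad:
  fixes f :: "real ^ 'd \<Rightarrow> real"
  assumes "\<And>y. f differentiable (at y)"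
  shows "grad f \<in> borel_measurable borel"
proof -
  \<comment> \<open>A deterministic function is treated as a stochastic one with a one-point sample
    space.\<close>
  have "(\<lambda>(y, z). stoch_grad (\<lambda>y (z :: unit). f y) y z) \<in> borel_measurable (borel \<Otimes>\<^sub>M count_space UNIV)"
    by (intro borel_measurable_stoch_grad) (auto intro: assms)
  from measurable_compose[OF measurable_Pair2'[of "()"] this] show ?thesis
    by (simp add: stoch_grad_def)
qed

section \<open>Independence and product laws\<close>

lemma indep_rv_distr_eq_pair_measure:
  assumes "prob_space M" "indep_rv M S U T V"
  shows "distr M (S \<Otimes>\<^sub>M T) (\<lambda>\<omega>. (U \<omega>, V \<omega>)) = distr M S U \<Otimes>\<^sub>M distr M T V"
proof -
  interpret prob_space M by fact
  have [measurable]: "U \<in> measurable M S" "V \<in> measurable M T"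
    and ind: "indep_set {U -` A \<inter> space M | A. A \<in> sets S} {V -` B \<inter> space M | B. B \<in> sets T}"
    using assms(2) by (auto simp: indep_rv_def)
  interpret U: prob_space "distr M S U" by (rule prob_space_distr) measurable
  interpret V: prob_space "distr M T V" by (rule prob_space_distr) measurable
  show ?thesis
  proof (rule pair_measure_eqI[symmetric])
    fix A B assume "A \<in> sets (distr M S U)" "B \<in> sets (distr M T V)"
    then have AB: "A \<in> sets S" "B \<in> sets T" by auto
    have "prob ((U -` A \<inter> space M) \<inter> (V -` B \<inter> space M)) = prob (U -` A \<inter> space M) * prob (V -` B \<inter> space M)"
      using AB by (intro indep_setD[OF ind]) auto
    moreover have "(\<lambda>\<omega>. (U \<omega>, V \<omega>)) -` (A \<times> B) \<inter> space M = (U -` A \<inter> space M) \<inter> (V -` B \<inter> space M)"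
      by auto
    ultimately show "emeasure (distr M S U) A * emeasure (distr M T V) B
        = emeasure (distr M (S \<Otimes>\<^sub>M T) (\<lambda>\<omega>. (U \<omega>, V \<omega>))) (A \<times> B)"
      using AB by (simp add: emeasure_distr emeasure_eq_measure ennreal_mult)
  qed (auto intro: U.sigma_finite_measure_axioms V.sigma_finite_measure_axioms)
qed

text \<open>This takes the place of conditioning on \<open>V\<close>: its value is frozen while
  \<open>U\<close> is integrated against its own law.\<close>

lemma nn_integral_indep_rv:
  assumes "prob_space M" "indep_rv M S U T V" "\<phi> \<in> borel_measurable (S \<Otimes>\<^sub>M T)"
  shows "(\<integral>\<^sup>+\<omega>. \<phi> (U \<omega>, V \<omega>) \<partial>M) = (\<integral>\<^sup>+\<omega>. (\<integral>\<^sup>+u. \<phi> (u, V \<omega>) \<partial>distr M S U) \<partial>M)"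
proof -
  interpret prob_space M by fact
  have [measurable]: "U \<in> measurable M S" "V \<in> measurable M T"
    using assms(2) by (auto simp: indep_rv_def)
  note [measurable] = assms(3)
  interpret U: prob_space "distr M S U" by (rule prob_space_distr) measurable
  interpret V: prob_space "distr M T V" by (rule prob_space_distr) measurable
  interpret UV: pair_sigma_finite "distr M S U" "distr M T V" ..
  have "(\<integral>\<^sup>+\<omega>. \<phi> (U \<omega>, V \<omega>) \<partial>M) = integral\<^sup>N (distr M (S \<Otimes>\<^sub>M T) (\<lambda>\<omega>. (U \<omega>, V \<omega>))) \<phi>"
    by (subst nn_integral_distr) auto
  also have "\<dots> = (\<integral>\<^sup>+v. (\<integral>\<^sup>+u. \<phi> (u, v) \<partial>distr M S U) \<partial>distr M T V)"
    unfolding indep_rv_distr_eq_pair_measure[OF assms(1,2)]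
    by (rule UV.nn_integral_snd[symmetric]) simp
  also have "\<dots> = (\<integral>\<^sup>+\<omega>. (\<integral>\<^sup>+u. \<phi> (u, V \<omega>) \<partial>distr M S U) \<partial>M)"
    by (subst nn_integral_distr) (auto intro!: U.borel_measurable_nn_integral)
  finally show ?thesis .
qed

section \<open>The variance-reduced run\<close>

text \<open>A fresh batch is independent of the history, so the previous estimate has to be exhibited as a
  function of the history.\<close>

primrec history_estimate ::
  "(real ^ 'd \<Rightarrow> 'z \<Rightarrow> real) \<Rightarrow> nat \<Rightarrow> nat \<Rightarrow> nat \<Rightarrow> nat \<Rightarrow>
    (nat \<Rightarrow> real ^ 'd) \<times> (nat \<times> nat \<Rightarrow> 'z) \<Rightarrow> real ^ 'd" where
  "history_estimate F q0 m1 m 0 h = 0"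
| "history_estimate F q0 m1 m (Suc k) h =
    (if [Suc k = 1] (mod q0)
     then (1 / real (batch q0 m1 m (Suc k))) *\<^sub>R
            (\<Sum>i = 1..batch q0 m1 m (Suc k). stoch_grad F (fst h (Suc k)) (snd h (Suc k, i)))
     else (1 / real (batch q0 m1 m (Suc k))) *\<^sub>R
            ((\<Sum>i = 1..batch q0 m1 m (Suc k). stoch_grad F (fst h (Suc k)) (snd h (Suc k, i)))
             - (\<Sum>i = 1..batch q0 m1 m (Suc k). stoch_grad F (fst h k) (snd h (Suc k, i))))
          + history_estimate F q0 m1 m k h)"

text \<open>The two horizons are separate because the history before batch k contains the iterates
  up to k but the samples only up to k - 1.\<close>

lemma borel_measurable_history_estimate:
  fixes F :: "real ^ 'd \<Rightarrow> 'z \<Rightarrow> real"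
  assumes sg: "(\<lambda>(y, z). stoch_grad F y z) \<in> borel_measurable (borel \<Otimes>\<^sub>M D)"
    and "k \<le> n" "k \<le> n'"
  shows "history_estimate F q0 m1 m k
    \<in> borel_measurable (Pi\<^sub>M {1..n} (\<lambda>_. borel) \<Otimes>\<^sub>M Pi\<^sub>M (sample_indices q0 m1 m n') (\<lambda>_. D))"
    (is "_ \<in> borel_measurable ?H")
  using assms(2,3)
proof (induction k)
  case 0
  then show ?case by simp
next
  case (Suc k)
  have x: "(\<lambda>h. fst h j) \<in> measurable ?H borel" if "j \<in> {1..n}" for j
    by (rule measurable_compose[OF measurable_fst measurable_component_singleton[OF that]])
  have z: "(\<lambda>h. snd h p) \<in> measurable ?H D" if "p \<in> sample_indices q0 m1 m n'" for p
    by (rule measurable_compose[OF measurable_snd measurable_component_singleton[OF that]])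
  have "(\<lambda>h. stoch_grad F (fst h j) (snd h p)) \<in> borel_measurable ?H"
    if "j \<in> {1..n}" "p \<in> sample_indices q0 m1 m n'" for j p
    using measurable_compose[OF measurable_Pair[OF x[OF that(1)] z[OF that(2)]] sg] by simp
  moreover have "(Suc k, i) \<in> sample_indices q0 m1 m n'" if "i \<in> {1..batch q0 m1 m (Suc k)}" for i
    using that Suc.prems by (simp add: sample_indices_def)
  ultimately have sum: "(\<lambda>h. \<Sum>i = 1..batch q0 m1 m (Suc k). stoch_grad F (fst h j) (snd h (Suc k, i)))
      \<in> borel_measurable ?H" if "j \<in> {1..n}" for j
    using that by (intro borel_measurable_sum) auto
  show ?case
  proof (cases "[Suc k = 1] (mod q0)")
    case True
    have "Suc k \<in> {1..n}" using Suc.prems by simp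
    from sum[OF this] show ?thesis
      unfolding history_estimate.simps if_P[OF True] by (intro borel_measurable_scaleR) auto
  next
    case False
    \<comment> \<open>Index 1 is a restart for every \<open>q0\<close>, so a difference estimate
      always has a genuine preceding iterate.\<close>
    then have "k \<noteq> 0" by (intro notI) simp
    then have "k \<in> {1..n}" "Suc k \<in> {1..n}" using Suc.prems by auto
    from sum[OF this(1)] sum[OF this(2)] Suc show ?thesis
      unfolding history_estimate.simps if_not_P[OF False]
      by (intro borel_measurable_add borel_measurable_scaleR borel_measurable_diff) auto
  qed
qed

lemma average_const:
  fixes c :: "real ^ 'd"
  assumes "0 < n"
  shows "(1 / real n) *\<^sub>R (\<Sum>i = 1..n. c) = c"
  using assms by (simp only: sum_constant_scaleR) simp

text \<open>Stepsize 1 / L and uniform weights are built in, while \<open>K\<close>,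
  \<open>q0\<close>, \<open>m1\<close>, \<open>m\<close> and \<psi> stay free: the bounds on error
  and residual are first obtained for arbitrary sizes.\<close>

locale l1_ball_run =
  stochastic_problem X \<Xi> D F L \<sigma> f_low +
  variance_reduced_method M X D F "ind_fun {z. l1_norm z \<le> \<psi>}" "\<lambda>_. 1 / L" "\<lambda>_. 1 / real K"
    K q0 m1 m \<zeta> G x Y
  for X :: "(real ^ 'd) set" and \<Xi> :: "'z::euclidean_space set" and D F L \<sigma> f_low
    and M :: "'w measure" and K q0 m1 m \<zeta> G x Y \<psi> +
  assumes psi_pos: "0 < \<psi>" and L_pos: "0 < L"
begin

sublocale M: prob_space M by (rule M_prob)
sublocale D: prob_space D by (rule D_prob)

abbreviation f where "f \<equiv> objective D F"

abbreviation history where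
  "history k \<omega> \<equiv> (\<lambda>j\<in>{1..k}. x j \<omega>, \<lambda>q\<in>sample_indices q0 m1 m (k - 1). \<zeta> (fst q) (snd q) \<omega>)"

abbreviation history_space where
  "history_space k \<equiv> Pi\<^sub>M {1..k} (\<lambda>_. borel :: (real ^ 'd) measure) \<Otimes>\<^sub>M
     Pi\<^sub>M (sample_indices q0 m1 m (k - 1)) (\<lambda>_. D)"

definition error where "error k \<omega> = G k \<omega> - grad f (x k \<omega>)"

lemma space_D: "space D = \<Xi>"
  using sets_eq_imp_space_eq[OF D_sets] by (simp add: space_restrict_space)

lemma stoch_grad_measurable: "(\<lambda>(y, z). stoch_grad F y z) \<in> borel_measurable (borel \<Otimes>\<^sub>M D)"
  by (intro borel_measurable_stoch_grad) (use F_integrable F_differentiable space_D in auto)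

lemma grad_measurable [measurable]: "grad f \<in> borel_measurable borel"
  by (intro borel_measurable_grad f_differentiable)

lemma iterate_in:
  assumes "k \<in> {1..K + 1}" "\<omega> \<in> space M"
  shows "x k \<omega> \<in> X"
proof (cases "k = 1")
  case False
  then obtain j where "j \<in> {1..K}" "k = j + 1" using assms(1) by (cases k) auto
  then show ?thesis using update[of j \<omega>] assms(2) by (simp add: is_arg_min_def)
qed (use start assms in simp)

lemma l1_norm_step_le:
  assumes "k \<in> {1..K}" "\<omega> \<in> space M"
  shows "l1_norm (x (k + 1) \<omega> - x k \<omega>) \<le> \<psi>"
proof (rule prox_step_l1_ball(2)[OF X_closed X_convex _ psi_pos update[OF assms]])
  show "x k \<omega> \<in> X" using assms by (intro iterate_in) auto
qed

text \<open>Independence of the output index from the tuple of iterates includes measurability of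
  that tuple.\<close>

lemma iterate_measurable:
  assumes "k \<in> {1..K + 1}"
  shows "x k \<in> borel_measurable M"
proof -
  have "(\<lambda>\<omega>. \<lambda>k\<in>{1..K + 1}. x k \<omega>) \<in> measurable M (Pi\<^sub>M {1..K + 1} (\<lambda>_. borel))"
    using output_indep by (simp add: indep_rv_def)
  from measurable_compose[OF this measurable_component_singleton[OF assms]] show ?thesis
    using assms by simp
qed

lemma estimate_eq:
  assumes "k \<in> {1..K}" "\<omega> \<in> space M" "k \<le> n" "k \<le> n'"
  shows "G k \<omega> = history_estimate F q0 m1 m k
    (\<lambda>j\<in>{1..n}. x j \<omega>, \<lambda>q\<in>sample_indices q0 m1 m n'. \<zeta> (fst q) (snd q) \<omega>)"
    (is "_ = history_estimate F q0 m1 m k ?h")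
proof -
  define h where "h = ?h"
  have x: "fst h j = x j \<omega>" if "j \<in> {1..n}" for j using that by (simp add: h_def)
  have z: "snd h q = \<zeta> (fst q) (snd q) \<omega>" if "q \<in> sample_indices q0 m1 m n'" for q
    using that by (simp add: h_def)
  have "G k \<omega> = history_estimate F q0 m1 m k h"
    using assms
  proof (induction k)
    case (Suc k)
    have z': "snd h (Suc k, i) = \<zeta> (Suc k) i \<omega>" if "i \<in> {1..batch q0 m1 m (Suc k)}" for i
      using that Suc.prems by (subst z) (auto simp: sample_indices_def)
    have sum_eq: "(\<Sum>i = 1..batch q0 m1 m (Suc k). stoch_grad F y (snd h (Suc k, i)))
        = (\<Sum>i = 1..batch q0 m1 m (Suc k). stoch_grad F y (\<zeta> (Suc k) i \<omega>))" for y
      by (intro sum.cong refl) (simp only: z')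
    have x': "fst h (Suc k) = x (Suc k) \<omega>" using Suc.prems by (intro x) simp
    note est = estimate[OF Suc.prems(1,2)]
    show ?case
    proof (cases "[Suc k = 1] (mod q0)")
      case True
      show ?thesis
        unfolding est history_estimate.simps if_P[OF True] x' sum_eq ..
    next
      case False
      then have "k \<noteq> 0" by (intro notI) simp
      then have IH: "G k \<omega> = history_estimate F q0 m1 m k h" and x'': "fst h k = x k \<omega>"
        using Suc x by auto
      show ?thesis
        unfolding est history_estimate.simps if_not_P[OF False] x' x'' diff_Suc_1 IH sum_eq ..
    qed
  qed simp
  then show ?thesis by (simp only: h_def)
qed

section \<open>The error of the gradient estimates\<close>

lemma sample_batch_distr:
  assumes "k \<in> {1..K}"
  shows "distr M (Pi\<^sub>M {1..batch q0 m1 m k} (\<lambda>_. D)) (\<lambda>\<omega>. \<lambda>i\<in>{1..batch q0 m1 m k}. \<zeta> k i \<omega>)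
    = Pi\<^sub>M {1..batch q0 m1 m k} (\<lambda>_. D)"
proof -
  have law: "\<zeta> k i \<in> measurable M D" "distr M D (\<zeta> k i) = D" if "i \<in> {1..batch q0 m1 m k}" for i
    using sample_law[of k i] assms that by (auto simp: sample_indices_def)
  have "{1..batch q0 m1 m k} \<noteq> {}" using sizes_pos by (simp add: batch_def)
  note M.indep_vars_iff_distr_eq_PiM'[OF this law(1), THEN iffD1, OF _ sample_indep[OF assms]]
  also have "Pi\<^sub>M {1..batch q0 m1 m k} (\<lambda>i. distr M D (\<zeta> k i)) = Pi\<^sub>M {1..batch q0 m1 m k} (\<lambda>_. D)"
    by (intro PiM_cong refl law(2))
  finally show ?thesis .
qed

text \<open>The common form of a restart and of a difference step: a part \<open>a\<close> known
  from the history plus an average of fresh terms that are centered once the history is frozen. Each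
  of the b samples costs 2 V / (b^2 \<mu>), which adds up to 2 V / (b \<mu>).\<close>

lemma nn_integral_soft_infnorm_error_le:
  assumes k: "k \<in> {1..K}" and "0 < \<mu>"
    and a[measurable]: "a \<in> borel_measurable (history_space k)"
    and W[measurable]: "case_prod W \<in> borel_measurable (history_space k \<Otimes>\<^sub>M D)"
    and mean: "\<And>\<omega>. \<omega> \<in> space M \<Longrightarrow> has_bochner_integral D (W (history k \<omega>)) 0"
    and V: "\<And>\<omega>. \<omega> \<in> space M \<Longrightarrow>
        (\<integral>\<^sup>+z. ennreal ((infnorm (W (history k \<omega>) z))\<^sup>2) \<partial>D) \<le> ennreal V" "0 \<le> V"
    and err: "\<And>\<omega>. \<omega> \<in> space M \<Longrightarrow> error k \<omega> = a (history k \<omega>) +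
        (1 / real (batch q0 m1 m k)) *\<^sub>R (\<Sum>i = 1..batch q0 m1 m k. W (history k \<omega>) (\<zeta> k i \<omega>))"
  shows "(\<integral>\<^sup>+\<omega>. ennreal (soft_infnorm \<mu> (error k \<omega>)) \<partial>M)
    \<le> (\<integral>\<^sup>+\<omega>. ennreal (soft_infnorm \<mu> (a (history k \<omega>))) \<partial>M)
      + ennreal (2 * V / (real (batch q0 m1 m k) * \<mu>))"
proof -
  define b where "b = batch q0 m1 m k"
  have b: "0 < b" using sizes_pos by (simp add: b_def batch_def)
  let ?Z = "\<lambda>\<omega>. \<lambda>i\<in>{1..b}. \<zeta> k i \<omega>"
  define \<phi> where "\<phi> p = ennreal (soft_infnorm \<mu> (a (snd p) + (1 / real b) *\<^sub>R (\<Sum>i\<in>{1..b}. W (snd p) (fst p i))))" for p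
  have ind: "indep_rv M (Pi\<^sub>M {1..b} (\<lambda>_. D)) ?Z (history_space k) (history k)"
    unfolding b_def by (rule sample_fresh[OF k])
  have hist[measurable]: "history k \<in> measurable M (history_space k)"
    using ind by (simp add: indep_rv_def)
  have "(\<lambda>p. W (snd p) (fst p i)) \<in> borel_measurable (Pi\<^sub>M {1..b} (\<lambda>_. D) \<Otimes>\<^sub>M history_space k)"
    if "i \<in> {1..b}" for i
  proof -
    have "(\<lambda>p. (snd p, fst p i)) \<in> measurable (Pi\<^sub>M {1..b} (\<lambda>_. D) \<Otimes>\<^sub>M history_space k) (history_space k \<Otimes>\<^sub>M D)"
      by (intro measurable_Pair measurable_snd
          measurable_compose[OF measurable_fst measurable_component_singleton[OF that]])
    from measurable_compose[OF this W] show ?thesis by simp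
  qed
  then have "(\<lambda>p. \<Sum>i\<in>{1..b}. W (snd p) (fst p i)) \<in> borel_measurable (Pi\<^sub>M {1..b} (\<lambda>_. D) \<Otimes>\<^sub>M history_space k)"
    by (intro borel_measurable_sum)
  then have \<phi>: "\<phi> \<in> borel_measurable (Pi\<^sub>M {1..b} (\<lambda>_. D) \<Otimes>\<^sub>M history_space k)"
    unfolding \<phi>_def[abs_def] by measurable
  have "(\<integral>\<^sup>+\<omega>. ennreal (soft_infnorm \<mu> (error k \<omega>)) \<partial>M) = (\<integral>\<^sup>+\<omega>. \<phi> (?Z \<omega>, history k \<omega>) \<partial>M)"
    by (intro nn_integral_cong) (simp add: err \<phi>_def b_def[symmetric])
  also have "\<dots> = (\<integral>\<^sup>+\<omega>. (\<integral>\<^sup>+u. \<phi> (u, history k \<omega>) \<partial>distr M (Pi\<^sub>M {1..b} (\<lambda>_. D)) ?Z) \<partial>M)"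
    by (rule nn_integral_indep_rv[OF M_prob ind \<phi>])
  also have "\<dots> = (\<integral>\<^sup>+\<omega>. (\<integral>\<^sup>+u. \<phi> (u, history k \<omega>) \<partial>Pi\<^sub>M {1..b} (\<lambda>_. D)) \<partial>M)"
    using sample_batch_distr[OF k] by (simp add: b_def)
  also have "\<dots> \<le> (\<integral>\<^sup>+\<omega>. ennreal (soft_infnorm \<mu> (a (history k \<omega>)) + 2 * V / (real b * \<mu>)) \<partial>M)"
  proof (rule nn_integral_mono)
    fix \<omega> assume \<omega>: "\<omega> \<in> space M"
    have "(\<integral>\<^sup>+u. \<phi> (u, history k \<omega>) \<partial>Pi\<^sub>M {1..b} (\<lambda>_. D))
        \<le> ennreal (soft_infnorm \<mu> (a (history k \<omega>)) + real (card {1..b}) * (2 * (1 / real b)\<^sup>2 * V / \<mu>))"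
      unfolding \<phi>_def fst_conv snd_conv
      by (intro D.nn_integral_soft_infnorm_sum_le mean[OF \<omega>] V(1)[OF \<omega>] V(2) \<open>0 < \<mu>\<close>) simp
    also have "real (card {1..b}) * (2 * (1 / real b)\<^sup>2 * V / \<mu>) = 2 * V / (real b * \<mu>)"
      using b by (simp add: power2_eq_square)
    finally show "(\<integral>\<^sup>+u. \<phi> (u, history k \<omega>) \<partial>Pi\<^sub>M {1..b} (\<lambda>_. D))
        \<le> ennreal (soft_infnorm \<mu> (a (history k \<omega>)) + 2 * V / (real b * \<mu>))" .
  qed
  also have "\<dots> = (\<integral>\<^sup>+\<omega>. ennreal (soft_infnorm \<mu> (a (history k \<omega>))) + ennreal (2 * V / (real b * \<mu>)) \<partial>M)"
    using V(2) \<open>0 < \<mu>\<close> by (simp add: soft_infnorm_nonneg)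
  also have "\<dots> = (\<integral>\<^sup>+\<omega>. ennreal (soft_infnorm \<mu> (a (history k \<omega>))) \<partial>M) + ennreal (2 * V / (real b * \<mu>))"
  proof (subst nn_integral_add)
    show "(\<lambda>\<omega>. ennreal (soft_infnorm \<mu> (a (history k \<omega>)))) \<in> borel_measurable M" by measurable
  qed (simp_all add: M.emeasure_space_1)
  finally show ?thesis by (simp add: b_def)
qed

lemma history_iterate_measurable:
  "j \<in> {1..k} \<Longrightarrow> (\<lambda>h. fst h j) \<in> measurable (history_space k) borel"
  by (rule measurable_compose[OF measurable_fst measurable_component_singleton])

lemma history_stoch_grad_measurable:
  assumes "j \<in> {1..k}"
  shows "(\<lambda>p. stoch_grad F (fst (fst p) j) (snd p)) \<in> borel_measurable (history_space k \<Otimes>\<^sub>M D)"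
proof -
  have "(\<lambda>p. (fst (fst p) j, snd p)) \<in> measurable (history_space k \<Otimes>\<^sub>M D) (borel \<Otimes>\<^sub>M D)"
    by (intro measurable_Pair measurable_snd measurable_compose[OF measurable_fst history_iterate_measurable[OF assms]])
  from measurable_compose[OF this stoch_grad_measurable] show ?thesis by simp
qed

lemma history_grad_measurable:
  assumes "j \<in> {1..k}"
  shows "(\<lambda>h. grad f (fst h j)) \<in> borel_measurable (history_space k)"
  by (rule measurable_compose[OF history_iterate_measurable[OF assms] grad_measurable])

text \<open>A restart forgets the previous error, so the base point is 0. The majorant is positive
  there, and its value \<mu> ln (2 d) enters once per interval.\<close>

lemma error_restart_le:
  assumes k: "k \<in> {1..K}" "[k = 1] (mod q0)" and "0 < \<mu>"
  shows "(\<integral>\<^sup>+\<omega>. ennreal (soft_infnorm \<mu> (error k \<omega>)) \<partial>M)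
    \<le> ennreal (\<mu> * ln (2 * real CARD('d)) + 2 * \<sigma>\<^sup>2 / (real m1 * \<mu>))"
proof -
  have b: "batch q0 m1 m k = m1" using k by (simp add: batch_def)
  have kk: "k \<in> {1..k}" using k by simp
  define W where "W h z = stoch_grad F (fst h k) z - grad f (fst h k)" for h :: "(nat \<Rightarrow> real ^ 'd) \<times> (nat \<times> nat \<Rightarrow> 'z)" and z
  have "(\<integral>\<^sup>+\<omega>. ennreal (soft_infnorm \<mu> (error k \<omega>)) \<partial>M)
    \<le> (\<integral>\<^sup>+\<omega>. ennreal (soft_infnorm \<mu> (0 :: real ^ 'd)) \<partial>M) + ennreal (2 * \<sigma>\<^sup>2 / (real (batch q0 m1 m k) * \<mu>))"
  proof (rule nn_integral_soft_infnorm_error_le[OF k(1) \<open>0 < \<mu>\<close>, where W = W and a = "\<lambda>_. 0"])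
    show "case_prod W \<in> borel_measurable (history_space k \<Otimes>\<^sub>M D)"
      unfolding W_def case_prod_beta'
      by (intro borel_measurable_diff history_stoch_grad_measurable kk
          measurable_compose[OF measurable_fst history_grad_measurable])
  next
    fix \<omega> assume \<omega>: "\<omega> \<in> space M"
    have X: "x k \<omega> \<in> X" using k \<omega> by (intro iterate_in) auto
    have W_eq: "W (history k \<omega>) = (\<lambda>z. stoch_grad F (x k \<omega>) z - grad f (x k \<omega>))"
      using kk by (simp add: W_def fun_eq_iff)
    have const: "has_bochner_integral D (\<lambda>_. c) c" for c :: "real ^ 'd"
      by (simp add: has_bochner_integral_iff D.prob_space)
    show "has_bochner_integral D (W (history k \<omega>)) 0"
      using has_bochner_integral_diff[OF unbiased[OF X] const[of "grad f (x k \<omega>)"]]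
      unfolding W_eq by (simp only: diff_self)
    show "(\<integral>\<^sup>+z. ennreal ((infnorm (W (history k \<omega>) z))\<^sup>2) \<partial>D) \<le> ennreal (\<sigma>\<^sup>2)"
      unfolding W_eq variance[symmetric] by (rule SUP_upper[OF X])
    have "G k \<omega> = (1 / real m1) *\<^sub>R (\<Sum>i = 1..m1. stoch_grad F (x k \<omega>) (\<zeta> k i \<omega>))"
      using estimate[OF k(1) \<omega>] k(2) by (simp add: b)
    moreover have "grad f (x k \<omega>) = (1 / real m1) *\<^sub>R (\<Sum>i = 1..m1. grad f (x k \<omega>))"
      by (rule average_const[symmetric]) (rule sizes_pos)
    ultimately show "error k \<omega> = 0 + (1 / real (batch q0 m1 m k)) *\<^sub>R
        (\<Sum>i = 1..batch q0 m1 m k. W (history k \<omega>) (\<zeta> k i \<omega>))"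
      unfolding W_eq b error_def sum_subtractf by (metis add_0 scaleR_diff_right)
  qed auto
  also have "\<dots> = ennreal (\<mu> * ln (2 * real CARD('d)) + 2 * \<sigma>\<^sup>2 / (real m1 * \<mu>))"
    using \<open>0 < \<mu>\<close> soft_infnorm_nonneg[of \<mu> "0 :: real ^ 'd"]
    by (simp add: M.emeasure_space_1 b soft_infnorm_0)
  finally show ?thesis .
qed

text \<open>The last proximal step has l1-length at most \<psi>, so the gradient difference has
  second moment at most (L \<psi>)^2. The constant 8 is the factor 4 from centering times the factor
  2 of the majorant.\<close>

lemma error_increment_le:
  assumes k: "k \<in> {1..K}" "\<not> [k = 1] (mod q0)" and "0 < \<mu>"
  shows "(\<integral>\<^sup>+\<omega>. ennreal (soft_infnorm \<mu> (error k \<omega>)) \<partial>M)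
    \<le> (\<integral>\<^sup>+\<omega>. ennreal (soft_infnorm \<mu> (error (k - 1) \<omega>)) \<partial>M) + ennreal (8 * (L * \<psi>)\<^sup>2 / (real m * \<mu>))"
proof -
  have b: "batch q0 m1 m k = m" using k by (simp add: batch_def)
  have "k \<noteq> 1" using k(2) by (intro notI) simp
  then have kk: "k \<in> {1..k}" "k - 1 \<in> {1..k}" "k - 1 \<in> {1..K}" using k by auto
  define W where "W h z = (stoch_grad F (fst h k) z - stoch_grad F (fst h (k - 1)) z)
      - (grad f (fst h k) - grad f (fst h (k - 1)))" for h :: "(nat \<Rightarrow> real ^ 'd) \<times> (nat \<times> nat \<Rightarrow> 'z)" and z
  define a where "a h = history_estimate F q0 m1 m (k - 1) h - grad f (fst h (k - 1))" for h
  have a: "a (history k \<omega>) = error (k - 1) \<omega>" if "\<omega> \<in> space M" for \<omega>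
    using estimate_eq[OF kk(3) that, of k "k - 1"] kk by (simp add: a_def error_def)
  have "(\<integral>\<^sup>+\<omega>. ennreal (soft_infnorm \<mu> (error k \<omega>)) \<partial>M)
    \<le> (\<integral>\<^sup>+\<omega>. ennreal (soft_infnorm \<mu> (a (history k \<omega>))) \<partial>M)
      + ennreal (2 * (4 * (L * \<psi>)\<^sup>2) / (real (batch q0 m1 m k) * \<mu>))"
  proof (rule nn_integral_soft_infnorm_error_le[OF k(1) \<open>0 < \<mu>\<close>, where W = W and a = a])
    show "a \<in> borel_measurable (history_space k)"
      unfolding a_def[abs_def]
      by (intro borel_measurable_diff borel_measurable_history_estimate stoch_grad_measurable
          history_grad_measurable kk) auto
    show "case_prod W \<in> borel_measurable (history_space k \<Otimes>\<^sub>M D)"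
      unfolding W_def case_prod_beta'
      by (intro borel_measurable_diff history_stoch_grad_measurable kk
          measurable_compose[OF measurable_fst history_grad_measurable])
  next
    fix \<omega> assume \<omega>: "\<omega> \<in> space M"
    have X: "x k \<omega> \<in> X" "x (k - 1) \<omega> \<in> X" using kk k \<omega> by (auto intro!: iterate_in)
    have W_eq: "W (history k \<omega>) = (\<lambda>z. (stoch_grad F (x k \<omega>) z - stoch_grad F (x (k - 1) \<omega>) z)
        - (grad f (x k \<omega>) - grad f (x (k - 1) \<omega>)))"
      using kk by (simp add: W_def fun_eq_iff)
    have diff: "has_bochner_integral D (\<lambda>z. stoch_grad F (x k \<omega>) z - stoch_grad F (x (k - 1) \<omega>) z)
        (grad f (x k \<omega>) - grad f (x (k - 1) \<omega>))"
      by (intro has_bochner_integral_diff unbiased X)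
    have const: "has_bochner_integral D (\<lambda>_. c) c" for c :: "real ^ 'd"
      by (simp add: has_bochner_integral_iff D.prob_space)
    show "has_bochner_integral D (W (history k \<omega>)) 0"
      using has_bochner_integral_diff[OF diff const[of "grad f (x k \<omega>) - grad f (x (k - 1) \<omega>)"]]
      unfolding W_eq by (simp only: diff_self)
    have "l1_norm (x k \<omega> - x (k - 1) \<omega>) \<le> \<psi>"
      using l1_norm_step_le[OF kk(3) \<omega>] kk by simp
    then have "L\<^sup>2 * (l1_norm (x k \<omega> - x (k - 1) \<omega>))\<^sup>2 \<le> L\<^sup>2 * \<psi>\<^sup>2"
      by (intro mult_left_mono power_mono l1_norm_nonneg) auto
    then have "(\<integral>\<^sup>+z. ennreal ((infnorm (stoch_grad F (x k \<omega>) z - stoch_grad F (x (k - 1) \<omega>) z))\<^sup>2) \<partial>D)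
        \<le> ennreal ((L * \<psi>)\<^sup>2)"
      using order_trans[OF mean_square_smooth[OF X]] by (simp add: power_mult_distrib ennreal_leI)
    then show "(\<integral>\<^sup>+z. ennreal ((infnorm (W (history k \<omega>) z))\<^sup>2) \<partial>D) \<le> ennreal (4 * (L * \<psi>)\<^sup>2)"
      unfolding W_eq
      by (rule D.infnorm_centered_second_moment_le[OF diff]) (use psi_pos L_pos in simp)
    have Gk: "G k \<omega> = (1 / real m) *\<^sub>R ((\<Sum>i = 1..m. stoch_grad F (x k \<omega>) (\<zeta> k i \<omega>))
        - (\<Sum>i = 1..m. stoch_grad F (x (k - 1) \<omega>) (\<zeta> k i \<omega>))) + G (k - 1) \<omega>"
      using estimate[OF k(1) \<omega>] k(2) by (simp add: b)
    have avg: "(1 / real m) *\<^sub>R (\<Sum>i = 1..m. W (history k \<omega>) (\<zeta> k i \<omega>))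
        = (1 / real m) *\<^sub>R ((\<Sum>i = 1..m. stoch_grad F (x k \<omega>) (\<zeta> k i \<omega>))
        - (\<Sum>i = 1..m. stoch_grad F (x (k - 1) \<omega>) (\<zeta> k i \<omega>))) - (grad f (x k \<omega>) - grad f (x (k - 1) \<omega>))"
      by (simp only: W_eq sum_subtractf scaleR_diff_right average_const[OF sizes_pos(4)])
    show "error k \<omega> = a (history k \<omega>) + (1 / real (batch q0 m1 m k)) *\<^sub>R
        (\<Sum>i = 1..batch q0 m1 m k. W (history k \<omega>) (\<zeta> k i \<omega>))"
      unfolding a[OF \<omega>] b error_def Gk avg by (simp add: algebra_simps)
  qed auto
  also have "(\<integral>\<^sup>+\<omega>. ennreal (soft_infnorm \<mu> (a (history k \<omega>))) \<partial>M)
      = (\<integral>\<^sup>+\<omega>. ennreal (soft_infnorm \<mu> (error (k - 1) \<omega>)) \<partial>M)"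
    by (intro nn_integral_cong) (simp only: a)
  finally show ?thesis by (simp add: b)
qed

text \<open>\<open>(k - 1) mod q0\<close> counts the difference steps since the last restart: it is
  0 at a restart and grows by 1 otherwise.\<close>

lemma nn_integral_soft_infnorm_error_bound:
  assumes "k \<in> {1..K}" "0 < \<mu>"
  shows "(\<integral>\<^sup>+\<omega>. ennreal (soft_infnorm \<mu> (error k \<omega>)) \<partial>M)
    \<le> ennreal (\<mu> * ln (2 * real CARD('d)) + 2 * \<sigma>\<^sup>2 / (real m1 * \<mu>)
        + real ((k - 1) mod q0) * (8 * (L * \<psi>)\<^sup>2 / (real m * \<mu>)))"
  using assms(1)
proof (induction k)
  case (Suc k)
  define A where "A = \<mu> * ln (2 * real CARD('d)) + 2 * \<sigma>\<^sup>2 / (real m1 * \<mu>)"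
  define B where "B = 8 * (L * \<psi>)\<^sup>2 / (real m * \<mu>)"
  have "0 \<le> A" "0 \<le> B" using \<open>0 < \<mu>\<close> soft_infnorm_nonneg[of \<mu> "0 :: real ^ 'd"]
    by (auto simp: A_def B_def soft_infnorm_0)
  show ?case
  proof (cases "[Suc k = 1] (mod q0)")
    case True
    have "(\<integral>\<^sup>+\<omega>. ennreal (soft_infnorm \<mu> (error (Suc k) \<omega>)) \<partial>M) \<le> ennreal A"
      unfolding A_def by (rule error_restart_le[OF Suc.prems True \<open>0 < \<mu>\<close>])
    also have "\<dots> \<le> ennreal (A + real ((Suc k - 1) mod q0) * B)"
      using \<open>0 \<le> B\<close> by (intro ennreal_leI) simp
    finally show ?thesis by (simp add: A_def B_def)
  next
    case False
    then have "k \<noteq> 0" by (intro notI) simp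
    \<comment> \<open>Between restarts the residue does not wrap around to 0.\<close>
    have "k mod q0 = Suc ((k - 1) mod q0)"
    proof -
      have "\<not> [k = 0] (mod q0)"
        using False cong_add_rcancel_nat[of k 1 0 q0] by simp
      then have "k mod q0 \<noteq> 0" by (simp add: cong_def)
      then show ?thesis using \<open>k \<noteq> 0\<close> mod_Suc[of "k - 1" q0] by (auto split: if_splits)
    qed
    have "(\<integral>\<^sup>+\<omega>. ennreal (soft_infnorm \<mu> (error (Suc k) \<omega>)) \<partial>M)
        \<le> (\<integral>\<^sup>+\<omega>. ennreal (soft_infnorm \<mu> (error k \<omega>)) \<partial>M) + ennreal B"
      using error_increment_le[OF Suc.prems False \<open>0 < \<mu>\<close>] by (simp add: B_def)
    also have "\<dots> \<le> ennreal (A + real ((k - 1) mod q0) * B) + ennreal B"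
      unfolding A_def B_def using Suc \<open>k \<noteq> 0\<close> by (intro add_right_mono Suc.IH) auto
    also have "\<dots> = ennreal (A + real ((Suc k - 1) mod q0) * B)"
      using \<open>0 \<le> A\<close> \<open>0 \<le> B\<close> \<open>k mod q0 = _\<close>
      by (subst ennreal_plus[symmetric]) (auto simp: algebra_simps)
    finally show ?thesis by (simp add: A_def B_def)
  qed
qed simp

lemma error_measurable:
  assumes "k \<in> {1..K}"
  shows "error k \<in> borel_measurable M"
proof -
  \<comment> \<open>The full record of the run, including the current batch: unlike G (k - 1), the
    estimate G k is not a function of the history before batch k.\<close>
  define h where "h \<omega> = (\<lambda>j\<in>{1..K}. x j \<omega>, \<lambda>q\<in>sample_indices q0 m1 m K. \<zeta> (fst q) (snd q) \<omega>)" for \<omega>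
  have "h \<in> measurable M (Pi\<^sub>M {1..K} (\<lambda>_. borel) \<Otimes>\<^sub>M Pi\<^sub>M (sample_indices q0 m1 m K) (\<lambda>_. D))"
    unfolding h_def
    by (intro measurable_Pair measurable_restrict iterate_measurable) (use sample_law in auto)
  then have "(\<lambda>\<omega>. history_estimate F q0 m1 m k (h \<omega>)) \<in> borel_measurable M"
    by (rule measurable_compose)
      (use assms in \<open>intro borel_measurable_history_estimate[OF stoch_grad_measurable], auto\<close>)
  then have "(\<lambda>\<omega>. history_estimate F q0 m1 m k (h \<omega>) - grad f (x k \<omega>)) \<in> borel_measurable M"
    using assms by (intro borel_measurable_diff measurable_compose[OF iterate_measurable grad_measurable]) auto
  then show ?thesis
    by (rule measurable_cong[THEN iffD1, rotated])
      (use assms in \<open>simp add: error_def h_def estimate_eq[of _ _ K K]\<close>)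
qed

section \<open>Telescoping and averaging over the output index\<close>

definition residual_bound where
  "residual_bound y = (if y \<in> X then l1_residual f X y else 0)"

lemma residual_bound_measurable [measurable]: "residual_bound \<in> borel_measurable borel"
  unfolding residual_bound_def[abs_def]
  by (intro borel_measurable_l1_residual X_closed continuous_on_grad)

text \<open>The one-step bounds are summed pathwise. Objective differences may be negative, so the
  telescoping is done in the reals; each complete bound \<open>c k\<close> is nonnegative, which
  allows the passage from the sum in \<open>ennreal\<close> and back.\<close>

lemma sum_residual_bound_le:
  assumes \<omega>: "\<omega> \<in> space M"
  shows "(\<Sum>k=1..K. residual_bound (x (k + 1) \<omega>))
    \<le> ennreal (3 * L * \<psi> * real K) + (\<Sum>k=1..K. 2 * ennreal (infnorm (error k \<omega>)))
      + ennreal ((f (x 1 \<omega>) - f_low) / \<psi>)"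
proof -
  define c where "c k = 3 * L * \<psi> + 2 * infnorm (error k \<omega>) + (f (x k \<omega>) - f (x (k + 1) \<omega>)) / \<psi>" for k
  have c: "0 \<le> c k \<and> residual_bound (x (k + 1) \<omega>) \<le> ennreal (c k)" if k: "k \<in> {1..K}" for k
  proof -
    have X: "x k \<omega> \<in> X" "x (k + 1) \<omega> \<in> X" using k \<omega> by (auto intro!: iterate_in)
    show ?thesis
      using l1_residual_step_le[OF X(1) psi_pos L_pos update[OF k \<omega>]] X
      by (simp add: c_def error_def residual_bound_def)
  qed
  have "(\<Sum>k=1..K. residual_bound (x (k + 1) \<omega>)) \<le> (\<Sum>k=1..K. ennreal (c k))"
    using c by (intro sum_mono) blast
  also have "\<dots> = ennreal (\<Sum>k=1..K. c k)"
    using c by (intro sum_ennreal) blast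
  also have "(\<Sum>k=1..K. c k) = 3 * L * \<psi> * real K + (\<Sum>k=1..K. 2 * infnorm (error k \<omega>))
      + (\<Sum>k=1..K. f (x k \<omega>) - f (x (k + 1) \<omega>)) / \<psi>"
    by (simp add: c_def sum.distrib sum_divide_distrib)
  also have "(\<Sum>k=1..K. f (x k \<omega>) - f (x (k + 1) \<omega>)) = f (x 1 \<omega>) - f (x (K + 1) \<omega>)"
  proof -
    have "(\<Sum>k=1..n. f (x k \<omega>) - f (x (k + 1) \<omega>)) = f (x 1 \<omega>) - f (x (n + 1) \<omega>)" for n
      by (induction n) auto
    then show ?thesis .
  qed
  also have "ennreal (3 * L * \<psi> * real K + (\<Sum>k=1..K. 2 * infnorm (error k \<omega>))
        + (f (x 1 \<omega>) - f (x (K + 1) \<omega>)) / \<psi>)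
      \<le> ennreal (3 * L * \<psi> * real K + (\<Sum>k=1..K. 2 * infnorm (error k \<omega>))
        + (f (x 1 \<omega>) - f_low) / \<psi>)"
    using f_bounded_below[OF iterate_in[OF _ \<omega>, of "K + 1"]] psi_pos
    by (intro ennreal_leI add_left_mono divide_right_mono) auto
  also have "\<dots> = ennreal (3 * L * \<psi> * real K) + (\<Sum>k=1..K. 2 * ennreal (infnorm (error k \<omega>)))
      + ennreal ((f (x 1 \<omega>) - f_low) / \<psi>)"
  proof -
    have "0 \<le> (f (x 1 \<omega>) - f_low) / \<psi>"
      using f_bounded_below[OF iterate_in[OF _ \<omega>, of 1]] psi_pos by simp
    moreover have "0 \<le> 3 * L * \<psi> * real K" using psi_pos L_pos by simp
    moreover have "(\<Sum>k=1..K. 2 * ennreal (infnorm (error k \<omega>))) = ennreal (\<Sum>k=1..K. 2 * infnorm (error k \<omega>))"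
      by (subst sum_ennreal[symmetric]) (auto simp: infnorm_pos_le ennreal_mult')
    ultimately show ?thesis by (simp add: sum_nonneg infnorm_pos_le)
  qed
  finally show ?thesis .
qed

lemma nn_integral_sum_residual_bound_le:
  assumes \<beta>: "\<And>k. k \<in> {1..K} \<Longrightarrow> (\<integral>\<^sup>+\<omega>. ennreal (infnorm (error k \<omega>)) \<partial>M) \<le> ennreal \<beta>" "0 \<le> \<beta>"
    and int: "integrable M (\<lambda>\<omega>. f (x 1 \<omega>))"
  shows "(\<Sum>k=1..K. \<integral>\<^sup>+\<omega>. residual_bound (x (k + 1) \<omega>) \<partial>M)
    \<le> ennreal (real K * (3 * L * \<psi> + 2 * \<beta>) + ((\<integral>\<omega>. f (x 1 \<omega>) \<partial>M) - f_low) / \<psi>)"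
proof -
  have [measurable]: "error k \<in> borel_measurable M" if "k \<in> {1..K}" for k
    by (rule error_measurable[OF that])
  have low: "f_low \<le> f (x 1 \<omega>)" if "\<omega> \<in> space M" for \<omega>
    using f_bounded_below[OF iterate_in[OF _ that, of 1]] by simp
  have "(\<Sum>k=1..K. \<integral>\<^sup>+\<omega>. residual_bound (x (k + 1) \<omega>) \<partial>M) = (\<integral>\<^sup>+\<omega>. (\<Sum>k=1..K. residual_bound (x (k + 1) \<omega>)) \<partial>M)"
    by (intro nn_integral_sum[symmetric] measurable_compose[OF iterate_measurable residual_bound_measurable]) auto
  also have "\<dots> \<le> (\<integral>\<^sup>+\<omega>. ennreal (3 * L * \<psi> * real K) + (\<Sum>k=1..K. 2 * ennreal (infnorm (error k \<omega>)))
      + ennreal ((f (x 1 \<omega>) - f_low) / \<psi>) \<partial>M)"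
    by (intro nn_integral_mono sum_residual_bound_le)
  also have "\<dots> = ennreal (3 * L * \<psi> * real K) + (\<Sum>k=1..K. 2 * (\<integral>\<^sup>+\<omega>. ennreal (infnorm (error k \<omega>)) \<partial>M))
      + (\<integral>\<^sup>+\<omega>. ennreal ((f (x 1 \<omega>) - f_low) / \<psi>) \<partial>M)"
  proof -
    have [measurable]: "(\<lambda>\<omega>. f (x 1 \<omega>)) \<in> borel_measurable M" using int by simp
    have [measurable]: "(\<lambda>\<omega>. \<Sum>k=1..K. 2 * ennreal (infnorm (error k \<omega>))) \<in> borel_measurable M"
      by (intro borel_measurable_sum) measurable
    have "(\<integral>\<^sup>+\<omega>. (\<Sum>k=1..K. 2 * ennreal (infnorm (error k \<omega>))) \<partial>M)
        = (\<Sum>k=1..K. 2 * (\<integral>\<^sup>+\<omega>. ennreal (infnorm (error k \<omega>)) \<partial>M))"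
      by (subst nn_integral_sum) (auto intro!: sum.cong nn_integral_cmult)
    then show ?thesis
      by (subst nn_integral_add; (measurable)?)+ (simp add: M.emeasure_space_1)
  qed
  also have "(\<integral>\<^sup>+\<omega>. ennreal ((f (x 1 \<omega>) - f_low) / \<psi>) \<partial>M) = ennreal (((\<integral>\<omega>. f (x 1 \<omega>) \<partial>M) - f_low) / \<psi>)"
    by (subst nn_integral_eq_integral) (use int low psi_pos in \<open>auto simp: M.prob_space\<close>)
  also have "ennreal (3 * L * \<psi> * real K) + (\<Sum>k=1..K. 2 * (\<integral>\<^sup>+\<omega>. ennreal (infnorm (error k \<omega>)) \<partial>M))
      + ennreal (((\<integral>\<omega>. f (x 1 \<omega>) \<partial>M) - f_low) / \<psi>)
    \<le> ennreal (3 * L * \<psi> * real K) + (\<Sum>k=1..K. ennreal (2 * \<beta>))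
      + ennreal (((\<integral>\<omega>. f (x 1 \<omega>) \<partial>M) - f_low) / \<psi>)"
    using \<beta> by (intro add_left_mono add_right_mono sum_mono) (auto simp: ennreal_mult' intro!: mult_left_mono)
  also have "\<dots> = ennreal (real K * (3 * L * \<psi> + 2 * \<beta>) + ((\<integral>\<omega>. f (x 1 \<omega>) \<partial>M) - f_low) / \<psi>)"
  proof -
    have "f_low \<le> (\<integral>\<omega>. f (x 1 \<omega>) \<partial>M)"
      using integral_mono[of M "\<lambda>_. f_low", OF _ int low] by (simp add: M.prob_space)
    then have 1: "0 \<le> ((\<integral>\<omega>. f (x 1 \<omega>) \<partial>M) - f_low) / \<psi>" using psi_pos by simp
    have 2: "0 \<le> 3 * L * \<psi> * real K" "0 \<le> real K * (2 * \<beta>)" using psi_pos L_pos \<beta>(2) by simp_all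
    have 3: "(\<Sum>k=1..K. ennreal (2 * \<beta>)) = ennreal (real K * (2 * \<beta>))"
      using \<beta>(2) by (simp add: ennreal_mult' ennreal_of_nat_eq_real_of_nat)
    show ?thesis
      unfolding 3 using 1 2 by (simp add: ennreal_plus[symmetric] algebra_simps del: ennreal_plus)
  qed
  finally show ?thesis .
qed

text \<open>Only the iterates are independent of \<open>Y\<close>, not the error of the estimates, hence the average over
  \<open>Y\<close> is taken for \<open>residual_bound\<close>, a Borel function of the iterate.\<close>

lemma nn_integral_output_residual_le:
  "(\<integral>\<^sup>+\<omega>. infnorm_dist0
      (frechet_subdifferential (\<lambda>y. ereal (f y) + ind_fun X y) (x (Y \<omega> + 1) \<omega>)) \<partial>M)
    \<le> ennreal (1 / real K) * (\<Sum>k=1..K. \<integral>\<^sup>+\<omega>. residual_bound (x (k + 1) \<omega>) \<partial>M)"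
proof -
  have Y[measurable]: "Y \<in> measurable M (count_space UNIV)"
    using output_indep by (simp add: indep_rv_def)
  have ev: "{\<omega> \<in> space M. Y \<omega> = k} \<in> sets M" for k by measurable
  have eq: "emeasure M {\<omega> \<in> space M. Y \<omega> = k} = ennreal (1 / real K)" if "k \<in> {1..K}" for k
    using output_law[OF that] by (simp add: M.emeasure_eq_measure)
  \<comment> \<open>The K prescribed probabilities already sum to 1, so \<open>Y\<close> almost
    surely takes no other value.\<close>
  have "{\<omega> \<in> space M. Y \<omega> \<in> {1..K}} = (\<Union>k\<in>{1..K}. {\<omega> \<in> space M. Y \<omega> = k})" by auto
  then have "M.prob {\<omega> \<in> space M. Y \<omega> \<in> {1..K}} = M.prob (\<Union>k\<in>{1..K}. {\<omega> \<in> space M. Y \<omega> = k})"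
    by (simp only:)
  also have "\<dots> = (\<Sum>k=1..K. M.prob {\<omega> \<in> space M. Y \<omega> = k})"
    by (intro M.finite_measure_finite_Union) (auto simp: ev disjoint_family_on_def)
  also have "\<dots> = 1" using sizes_pos output_law by simp
  finally have "M.prob {\<omega> \<in> space M. Y \<omega> \<in> {1..K}} = 1" .
  then have AE: "AE \<omega> in M. Y \<omega> \<in> {1..K}"
    by (subst (asm) M.prob_Collect_eq_1) auto
  have "(\<integral>\<^sup>+\<omega>. infnorm_dist0
      (frechet_subdifferential (\<lambda>y. ereal (f y) + ind_fun X y) (x (Y \<omega> + 1) \<omega>)) \<partial>M)
    \<le> (\<integral>\<^sup>+\<omega>. (\<Sum>k=1..K. indicator {k} (Y \<omega>) * residual_bound (x (k + 1) \<omega>)) \<partial>M)"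
  \<comment> \<open>The distance is only compared pointwise; from here on the integrands are
    measurable functions of \<open>Y\<close> and the iterates.\<close>
  proof (rule nn_integral_mono_AE, rule AE_mp[OF AE], intro AE_I2 impI)
    fix \<omega> assume \<omega>: "\<omega> \<in> space M" "Y \<omega> \<in> {1..K}"
    have X: "x (Y \<omega> + 1) \<omega> \<in> X" using \<omega> by (intro iterate_in) auto
    have "infnorm_dist0 (frechet_subdifferential (\<lambda>y. ereal (f y) + ind_fun X y) (x (Y \<omega> + 1) \<omega>))
        \<le> residual_bound (x (Y \<omega> + 1) \<omega>)"
      unfolding residual_bound_def if_P[OF X]
      by (intro infnorm_dist0_le_l1_residual f_differentiable X_convex X)
    also have "\<dots> = indicator {Y \<omega>} (Y \<omega>) * residual_bound (x (Y \<omega> + 1) \<omega>)" by simp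
    also have "\<dots> \<le> (\<Sum>k=1..K. indicator {k} (Y \<omega>) * residual_bound (x (k + 1) \<omega>))"
      using \<omega> by (intro member_le_sum[where f = "\<lambda>k. indicator {k} (Y \<omega>) * residual_bound (x (k + 1) \<omega>)"]) auto
    finally show "infnorm_dist0
        (frechet_subdifferential (\<lambda>y. ereal (f y) + ind_fun X y) (x (Y \<omega> + 1) \<omega>))
      \<le> (\<Sum>k=1..K. indicator {k} (Y \<omega>) * residual_bound (x (k + 1) \<omega>))" .
  qed
  also have "\<dots> = (\<Sum>k=1..K. \<integral>\<^sup>+\<omega>. indicator {k} (Y \<omega>) * residual_bound (x (k + 1) \<omega>) \<partial>M)"
    by (intro nn_integral_sum borel_measurable_times_ennreal
        measurable_compose[OF iterate_measurable residual_bound_measurable] measurable_compose[OF Y]) auto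
  also have "\<dots> = (\<Sum>k=1..K. ennreal (1 / real K) * (\<integral>\<^sup>+\<omega>. residual_bound (x (k + 1) \<omega>) \<partial>M))"
  proof (intro sum.cong refl)
    fix k assume k: "k \<in> {1..K}"
    define \<phi> where "\<phi> p = indicator {k} (fst p) * residual_bound (snd p (k + 1))" for p :: "nat \<times> (nat \<Rightarrow> real ^ 'd)"
    have "k + 1 \<in> {1..K + 1}" using k by simp
    note comp = measurable_compose[OF measurable_snd measurable_component_singleton[OF this]]
    have "\<phi> \<in> borel_measurable (count_space UNIV \<Otimes>\<^sub>M Pi\<^sub>M {1..K + 1} (\<lambda>_. borel))"
      unfolding \<phi>_def[abs_def]
      by (intro borel_measurable_times_ennreal measurable_compose[OF comp residual_bound_measurable]
          measurable_compose[OF measurable_fst]) auto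
    from nn_integral_indep_rv[OF M_prob output_indep this]
    have "(\<integral>\<^sup>+\<omega>. indicator {k} (Y \<omega>) * residual_bound (x (k + 1) \<omega>) \<partial>M)
        = (\<integral>\<^sup>+\<omega>. (\<integral>\<^sup>+u. indicator {k} u * residual_bound (x (k + 1) \<omega>) \<partial>distr M (count_space UNIV) Y) \<partial>M)"
      using k by (simp add: \<phi>_def)
    also have "\<dots> = (\<integral>\<^sup>+\<omega>. ennreal (1 / real K) * residual_bound (x (k + 1) \<omega>) \<partial>M)"
      using eq[OF k] by (simp add: nn_integral_multc emeasure_distr vimage_def Int_def conj_commute)
    also have "\<dots> = ennreal (1 / real K) * (\<integral>\<^sup>+\<omega>. residual_bound (x (k + 1) \<omega>) \<partial>M)"
      using k by (intro nn_integral_cmult measurable_compose[OF iterate_measurable residual_bound_measurable]) auto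
    finally show "(\<integral>\<^sup>+\<omega>. indicator {k} (Y \<omega>) * residual_bound (x (k + 1) \<omega>) \<partial>M)
        = ennreal (1 / real K) * (\<integral>\<^sup>+\<omega>. residual_bound (x (k + 1) \<omega>) \<partial>M)" .
  qed
  finally show ?thesis by (simp add: sum_distrib_left)
qed

end

section \<open>The parameter choice\<close>

text \<open>The restarts have the form 1 + q j with j \<le> K div q; the summand 1 accounts for j =
  0.\<close>

lemma card_cong_1_le:
  assumes "0 < q"
  shows "real (card {k \<in> {1..K}. [k = 1] (mod q)}) \<le> real K / real q + 1"
proof -
  have "{k \<in> {1..K}. [k = 1] (mod q)} \<subseteq> (\<lambda>j. 1 + q * j) ` {0..K div q}"
  proof
    fix k assume "k \<in> {k \<in> {1..K}. [k = 1] (mod q)}"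
    then have k: "1 \<le> k" "k \<le> K" "k mod q = 1 mod q" by (auto simp: cong_def)
    then have "q dvd k - 1" using mod_eq_dvd_iff_nat by blast
    then obtain j where "k - 1 = q * j" by (elim dvdE)
    then have kj: "k = 1 + q * j" using k by simp
    have "j = (q * j) div q" using \<open>0 < q\<close> by simp
    also have "\<dots> \<le> K div q" using kj k by (intro div_le_mono) simp
    finally show "k \<in> (\<lambda>j. 1 + q * j) ` {0..K div q}" using kj by auto
  qed
  then have "card {k \<in> {1..K}. [k = 1] (mod q)} \<le> card ((\<lambda>j. 1 + q * j) ` {0..K div q})"
    by (intro card_mono) auto
  also have "\<dots> \<le> card {0..K div q}" by (rule card_image_le) simp
  finally have "card {k \<in> {1..K}. [k = 1] (mod q)} \<le> K div q + 1" by simp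
  then have "real (card {k \<in> {1..K}. [k = 1] (mod q)}) \<le> real (K div q) + 1" by linarith
  moreover have "real (K div q) \<le> real K / real q" by (rule of_nat_div_le_of_nat)
  ultimately show ?thesis by linarith
qed

lemma sample_complexity_le:
  assumes "0 < q0"
  shows "real (sample_complexity q0 m1 m K) \<le> (real K / real q0 + 1) * real m1 + real K * real m"
proof -
  have "sample_complexity q0 m1 m K = (\<Sum>k=1..K. batch q0 m1 m k)"
    by (simp add: sample_complexity_def sample_indices_def)
  \<comment> \<open>Restarts are charged \<open>m\<close> on top of \<open>m1\<close>, which
    separates the two contributions.\<close>
  also have "\<dots> \<le> (\<Sum>k=1..K. (if [k = 1] (mod q0) then m1 else 0) + m)"
    by (intro sum_mono) (simp add: batch_def)
  also have "\<dots> = card {k \<in> {1..K}. [k = 1] (mod q0)} * m1 + K * m"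
    by (simp add: sum.distrib sum.If_cases Int_def)
  finally have "real (sample_complexity q0 m1 m K)
      \<le> real (card {k \<in> {1..K}. [k = 1] (mod q0)}) * real m1 + real K * real m"
    by (simp flip: of_nat_mult of_nat_add)
  also have "\<dots> \<le> (real K / real q0 + 1) * real m1 + real K * real m"
    by (intro add_right_mono mult_right_mono card_cong_1_le assms) simp
  finally show ?thesis .
qed

text \<open>Since e^2 \<ge> 4 and ln d \<ge> ln 2 \<ge> 2/3, \<Omega> is at least 8/3, and ln (2 d)
  \<le> 2 ln d \<le> \<Omega>. The second bound absorbs the value of the majorant at the
  origin.\<close>

lemma Omega_bounds:
  assumes "2 \<le> d"
  shows "2 \<le> Omega d" "ln (2 * real d) \<le> Omega d"
proof -
  have e: "4 \<le> (exp 1 :: real)\<^sup>2"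
    using power_mono[of 2 "exp 1 :: real" 2] exp_ge_add_one_self[of "1 :: real"] by simp
  have "2 / 3 \<le> ln (2 :: real)" by (rule ln2_ge_two_thirds)
  also have "\<dots> \<le> ln (real d)" using assms by simp
  finally have l: "2 / 3 \<le> ln (real d)" .
  then have "4 * ln (real d) \<le> Omega d"
    unfolding Omega_def using e by (intro mult_right_mono) auto
  moreover have "ln (2 * real d) = ln 2 + ln (real d)" using assms by (simp add: ln_mult)
  moreover have "ln 2 \<le> ln (real d)" using assms by simp
  ultimately show "2 \<le> Omega d" "ln (2 * real d) \<le> Omega d" using l by linarith+
qed

text \<open>Positivity of the rounded numbers excludes the degenerate data: \<open>K\<close> > 0
  forces \<Delta> L > 0, and \<open>m1\<close> > 0 forces \<sigma> > 0 and \<Omega> \<noteq> 0,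
  hence d \<ge> 2. The factor in \<open>m1\<close> is just \<Omega>^2.\<close>

lemma parameter_choiceD:
  assumes pc: "parameter_choice d L \<sigma> \<Delta> \<epsilon> \<eta> \<psi> K q0 m1 m" and "0 < \<epsilon>" "0 < d" "0 \<le> \<sigma>"
  defines "\<omega> \<equiv> Omega d"
  shows "2 \<le> d" "0 < \<sigma>" "0 < \<Delta> * L" "2 \<le> \<omega>"
    "\<Delta> * L / \<epsilon>\<^sup>2 \<le> real K" "real K \<le> \<Delta> * L / \<epsilon>\<^sup>2 + 1"
    "\<omega>\<^sup>2 * \<sigma>\<^sup>2 / \<epsilon>\<^sup>2 \<le> real m1" "real m1 \<le> \<omega>\<^sup>2 * \<sigma>\<^sup>2 / \<epsilon>\<^sup>2 + 1"
    "\<bar>real m - \<omega>\<^sup>2 * real q0\<bar> < 1" "\<bar>real q0 - sqrt (real m1) / \<omega>\<bar> < 1"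
    "0 < K" "0 < q0" "0 < m1" "0 < m"
proof -
  have K: "K = nat \<lceil>\<Delta> * L / \<epsilon>\<^sup>2\<rceil>"
    and "m1 = nat \<lceil>Omega d * (exp 1)\<^sup>2 * ln (real d) * \<sigma>\<^sup>2 / \<epsilon>\<^sup>2\<rceil>"
    using pc by (auto simp: parameter_choice_def)
  moreover have "Omega d * (exp 1)\<^sup>2 * ln (real d) = \<omega>\<^sup>2"
    by (simp add: \<omega>_def Omega_def power2_eq_square)
  ultimately have m1: "m1 = nat \<lceil>\<omega>\<^sup>2 * \<sigma>\<^sup>2 / \<epsilon>\<^sup>2\<rceil>" by simp
  show rest: "\<bar>real m - \<omega>\<^sup>2 * real q0\<bar> < 1" "\<bar>real q0 - sqrt (real m1) / \<omega>\<bar> < 1"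
    "0 < K" "0 < q0" "0 < m1" "0 < m"
    using pc by (auto simp: parameter_choice_def \<omega>_def)
  have "0 < \<Delta> * L / \<epsilon>\<^sup>2" using rest(3) unfolding K by simp
  then show "0 < \<Delta> * L" using \<open>0 < \<epsilon>\<close> by (simp add: zero_less_divide_iff)
  have "0 < \<omega>\<^sup>2 * \<sigma>\<^sup>2 / \<epsilon>\<^sup>2" using rest(5) unfolding m1 by simp
  then have nz: "\<omega> \<noteq> 0" "\<sigma> \<noteq> 0" by auto
  then show "0 < \<sigma>" using \<open>0 \<le> \<sigma>\<close> by simp
  have "d \<noteq> 1" using nz(1) by (intro notI) (simp add: \<omega>_def Omega_def)
  then show "2 \<le> d" using \<open>0 < d\<close> by simp
  then show "2 \<le> \<omega>" unfolding \<omega>_def by (rule Omega_bounds)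
  show "\<Delta> * L / \<epsilon>\<^sup>2 \<le> real K" "\<omega>\<^sup>2 * \<sigma>\<^sup>2 / \<epsilon>\<^sup>2 \<le> real m1"
    unfolding K m1 by (rule real_nat_ceiling_ge)+
  show "real K \<le> \<Delta> * L / \<epsilon>\<^sup>2 + 1"
    unfolding K using \<open>0 < \<Delta> * L / \<epsilon>\<^sup>2\<close> by linarith
  show "real m1 \<le> \<omega>\<^sup>2 * \<sigma>\<^sup>2 / \<epsilon>\<^sup>2 + 1"
    unfolding m1 using \<open>0 < \<omega>\<^sup>2 * \<sigma>\<^sup>2 / \<epsilon>\<^sup>2\<close> by linarith
qed

text \<open>The three smallness conditions absorb the roundings. \<epsilon> \<le> \<sigma> makes
  \<Omega> \<sigma> / \<epsilon> at least 1 and so covers those of \<open>m1\<close>,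
  \<open>m\<close> and \<open>q0\<close>; 2 \<epsilon>^2 \<le> \<Delta> L gives K \<le> 3/2 \<Delta>
  L / \<epsilon>^2; 4 \<sigma> \<epsilon> \<le> \<Delta> L pays for the extra restart batch. The
  total is (6 + 1 + 6) U, and 13 e^4 \<le> 1000.\<close>

lemma sample_complexity_parameter_choice_le:
  assumes pc: "parameter_choice d L \<sigma> \<Delta> \<epsilon> \<eta> \<psi> K q0 m1 m" and "0 < \<epsilon>" "0 < d" "0 \<le> \<sigma>"
    and small: "\<epsilon> \<le> \<sigma>" "4 * \<sigma> * \<epsilon> \<le> \<Delta> * L" "2 * \<epsilon>\<^sup>2 \<le> \<Delta> * L"
  shows "real (sample_complexity q0 m1 m K) \<le> C_complexity * (\<Delta> * L * (ln (real d))\<^sup>2 * \<sigma> / \<epsilon> ^ 3)"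
proof -
  define \<omega> where "\<omega> = Omega d"
  note pcD = parameter_choiceD[OF pc \<open>0 < \<epsilon>\<close> \<open>0 < d\<close> \<open>0 \<le> \<sigma>\<close>, folded \<omega>_def]
  have \<omega>: "2 \<le> \<omega>" and q0: "1 \<le> real q0" using pcD by auto
  define P where "P = \<Delta> * L"
  define r where "r = \<sigma> / \<epsilon>"
  have r: "1 \<le> r" using small \<open>0 < \<epsilon>\<close> by (simp add: r_def)
  define s where "s = sqrt (real m1)"
  have s: "0 \<le> s" "s * s = real m1" by (simp_all add: s_def)
  have "1 \<le> \<omega> * r" using mult_mono[of 1 \<omega> 1 r] \<omega> r by simp
  have "real m1 \<le> (\<omega> * r)\<^sup>2 + 1"
    using pcD(8) by (simp add: r_def power_mult_distrib power_divide)
  moreover have "1 \<le> (\<omega> * r)\<^sup>2" using \<open>1 \<le> \<omega> * r\<close> by (rule one_le_power)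
  ultimately have m1_le: "real m1 \<le> (2 * (\<omega> * r))\<^sup>2" by (simp add: power_mult_distrib)
  then have s_le: "s \<le> 2 * (\<omega> * r)"
    unfolding s_def using \<open>1 \<le> \<omega> * r\<close> by (intro real_le_lsqrt) auto
  \<comment> \<open>Rounding changes the interval length by less than 1, which is at most
    \<open>q0\<close> itself.\<close>
  have "s / \<omega> \<le> 2 * real q0" using pcD(10) q0 by (simp add: s_def)
  then have "s \<le> 2 * real q0 * \<omega>" using \<omega> by (simp add: pos_divide_le_eq)
  then have "s * s \<le> (2 * real q0 * \<omega>) * (2 * (\<omega> * r))"
    using s s_le \<omega> r by (intro mult_mono) auto
  then have "real m1 \<le> 4 * \<omega>\<^sup>2 * r * real q0" by (simp add: s power2_eq_square mult_ac)
  then have m1q: "real m1 / real q0 \<le> 4 * \<omega>\<^sup>2 * r" using q0 by (simp add: pos_divide_le_eq)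
  have "real m \<le> \<omega>\<^sup>2 * real q0 + 1" using pcD(9) by linarith
  also have "\<dots> \<le> \<omega>\<^sup>2 * (s / \<omega> + 1) + 1"
    using pcD(10) by (intro add_right_mono mult_left_mono) (auto simp: s_def)
  also have "\<dots> = \<omega> * s + \<omega>\<^sup>2 + 1" using \<omega> by (simp add: power2_eq_square field_simps)
  also have "\<dots> \<le> \<omega> * (2 * (\<omega> * r)) + \<omega>\<^sup>2 * r + \<omega>\<^sup>2 * r"
  proof (intro add_mono)
    show "\<omega> * s \<le> \<omega> * (2 * (\<omega> * r))" using s_le \<omega> by (intro mult_left_mono) auto
    show 1: "\<omega>\<^sup>2 \<le> \<omega>\<^sup>2 * r" using mult_left_mono[OF r, of "\<omega>\<^sup>2"] by simp
    have "1 \<le> \<omega>\<^sup>2" using \<omega> by (intro one_le_power) simp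
    then show "1 \<le> \<omega>\<^sup>2 * r" using 1 by linarith
  qed
  finally have m_le: "real m \<le> 4 * \<omega>\<^sup>2 * r" by (simp add: power2_eq_square)
  have "1 \<le> P / \<epsilon>\<^sup>2 / 2" using small(3) \<open>0 < \<epsilon>\<close> by (simp add: P_def field_simps)
  then have K_le: "real K \<le> 3 / 2 * (P / \<epsilon>\<^sup>2)" using pcD(6) by (simp add: P_def)
  define U where "U = P * \<omega>\<^sup>2 * \<sigma> / \<epsilon> ^ 3"
  have U: "P / \<epsilon>\<^sup>2 * (\<omega>\<^sup>2 * r) = U"
    using \<open>0 < \<epsilon>\<close> by (simp add: U_def r_def power2_eq_square power3_eq_cube)
  have "real K * (real m1 / real q0) \<le> (3 / 2 * (P / \<epsilon>\<^sup>2)) * (4 * \<omega>\<^sup>2 * r)"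
    using r pcD(3) by (intro mult_mono K_le m1q) (auto simp: P_def)
  also have "\<dots> = 6 * U" unfolding U[symmetric] by simp
  finally have 1: "real K * (real m1 / real q0) \<le> 6 * U" .
  have "real K * real m \<le> (3 / 2 * (P / \<epsilon>\<^sup>2)) * (4 * \<omega>\<^sup>2 * r)"
    using r pcD(3) by (intro mult_mono K_le m_le) (auto simp: P_def)
  also have "\<dots> = 6 * U" unfolding U[symmetric] by simp
  finally have 2: "real K * real m \<le> 6 * U" .
  have 3: "real m1 \<le> U"
  proof -
    have "real m1 \<le> 4 * \<sigma> * \<epsilon> * (\<omega>\<^sup>2 * \<sigma> / \<epsilon> ^ 3)"
      using m1_le \<open>0 < \<epsilon>\<close> by (simp add: r_def power2_eq_square power3_eq_cube field_simps)
    also have "\<dots> \<le> P * (\<omega>\<^sup>2 * \<sigma> / \<epsilon> ^ 3)"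
      unfolding P_def using small(2) \<open>0 < \<epsilon>\<close> \<open>0 \<le> \<sigma>\<close> by (intro mult_right_mono) auto
    finally show ?thesis by (simp add: U_def mult.assoc)
  qed
  have "real (sample_complexity q0 m1 m K) \<le> (real K / real q0 + 1) * real m1 + real K * real m"
    by (rule sample_complexity_le[OF pcD(12)])
  also have "\<dots> = real K * (real m1 / real q0) + real m1 + real K * real m"
    by (simp add: algebra_simps)
  also have "\<dots> \<le> 13 * U" using 1 2 3 by linarith
  also have "\<dots> = 13 * (exp 1 ^ 4) * (\<Delta> * L * (ln (real d))\<^sup>2 * \<sigma> / \<epsilon> ^ 3)"
    by (simp add: U_def P_def \<omega>_def Omega_def power_mult_distrib flip: power_mult)
  also have "\<dots> \<le> 1000 * (\<Delta> * L * (ln (real d))\<^sup>2 * \<sigma> / \<epsilon> ^ 3)"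
  proof (rule mult_right_mono)
    have "(exp 1 :: real) ^ 4 \<le> (272 / 100) ^ 4" using e_less_272 by (intro power_mono) auto
    also have "\<dots> \<le> 56" by (simp add: power_numeral_reduce)
    finally show "13 * (exp 1 :: real) ^ 4 \<le> 1000" by simp
    show "0 \<le> \<Delta> * L * (ln (real d))\<^sup>2 * \<sigma> / \<epsilon> ^ 3"
      using pcD(3) \<open>0 \<le> \<sigma>\<close> \<open>0 < \<epsilon>\<close> by (auto intro!: divide_nonneg_pos mult_nonneg_nonneg)
  qed
  finally show ?thesis by (simp add: C_complexity_def)
qed

text \<open>The smoothing parameter \<open>\<epsilon> / Omega d\<close> balances the term \<open>\<mu> ln (2 d)\<close> against the noise terms,
  which are of order \<open>\<epsilon>\<^sup>2 / (\<mu> (Omega d)\<^sup>2)\<close>.\<close>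

lemma (in l1_ball_run) nn_integral_infnorm_error_le:
  assumes pc: "parameter_choice CARD('d) L \<sigma> \<Delta> \<epsilon> \<eta> \<psi> K q0 m1 m" and "0 < \<epsilon>" and k: "k \<in> {1..K}"
  shows "(\<integral>\<^sup>+\<omega>. ennreal (infnorm (error k \<omega>)) \<partial>M) \<le> ennreal (10 * \<epsilon>)"
proof -
  define \<omega> where "\<omega> = Omega CARD('d)"
  note pcD = parameter_choiceD[OF pc \<open>0 < \<epsilon>\<close> zero_less_card_finite sigma_nonneg, folded \<omega>_def]
  have \<omega>: "2 \<le> \<omega>" by (rule pcD)
  define \<mu> where "\<mu> = \<epsilon> / \<omega>"
  have "0 < \<mu>" using \<omega> \<open>0 < \<epsilon>\<close> by (simp add: \<mu>_def)
  have L\<psi>: "L * \<psi> = \<epsilon>" using pc L_pos by (simp add: parameter_choice_def)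
  have 1: "\<mu> * ln (2 * real CARD('d)) \<le> \<epsilon>"
  proof -
    have "\<mu> * ln (2 * real CARD('d)) \<le> \<mu> * \<omega>"
      unfolding \<omega>_def using \<open>0 < \<mu>\<close> pcD(1) by (intro mult_left_mono Omega_bounds) auto
    then show ?thesis using \<omega> by (simp add: \<mu>_def)
  qed
  \<comment> \<open>With m1 \<ge> \<Omega>^2 \<sigma>^2 / \<epsilon>^2 the left side is at most 2
    \<epsilon> / \<Omega>, and \<Omega> \<ge> 2.\<close>
  have 2: "2 * \<sigma>\<^sup>2 / (real m1 * \<mu>) \<le> \<epsilon>"
  proof -
    have "\<omega> * \<sigma>\<^sup>2 * 2 \<le> \<omega> * \<sigma>\<^sup>2 * \<omega>" using \<omega> by (intro mult_left_mono) auto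
    also have "\<dots> = \<omega>\<^sup>2 * \<sigma>\<^sup>2 / \<epsilon>\<^sup>2 * \<epsilon>\<^sup>2" using \<open>0 < \<epsilon>\<close> by (simp add: power2_eq_square)
    also have "\<dots> \<le> real m1 * \<epsilon>\<^sup>2" by (intro mult_right_mono pcD(7)) simp
    finally have "2 * \<sigma>\<^sup>2 * \<omega> \<le> real m1 * \<epsilon>\<^sup>2" by (simp add: mult_ac)
    then have "2 * \<sigma>\<^sup>2 \<le> \<epsilon> * (real m1 * \<mu>)"
      using \<omega> by (simp add: \<mu>_def pos_le_divide_eq power2_eq_square mult_ac)
    then show ?thesis using \<open>0 < \<mu>\<close> pcD(13) by (simp add: pos_divide_le_eq)
  qed
  have 3: "real ((k - 1) mod q0) * (8 * (L * \<psi>)\<^sup>2 / (real m * \<mu>)) \<le> 8 * \<epsilon>"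
  proof -
    have q: "1 \<le> real q0" using pcD(12) by simp
    have "4 \<le> \<omega>\<^sup>2" using power_mono[OF \<omega>, of 2] by simp
    \<comment> \<open>Rounding may take up to 1 from \<omega>^2 q0; the gap between \<omega>^2 q0
      and \<omega> q0 is at least 2, so \<omega> q0 \<le> m remains true.\<close>
    then have "1 * 2 \<le> real q0 * (\<omega>\<^sup>2 - \<omega>)"
      using q \<omega> mult_mono[of 2 \<omega> 1 "\<omega> - 1"] by (intro mult_mono) (auto simp: power2_eq_square algebra_simps)
    then have "real q0 * \<omega> \<le> real m" using pcD(9) by (simp add: algebra_simps)
    moreover have "real ((k - 1) mod q0) * \<omega> \<le> real q0 * \<omega>"
      using \<omega> pcD(12) by (intro mult_right_mono) (auto simp: less_imp_le)
    ultimately have "real ((k - 1) mod q0) * \<omega> \<le> real m" by linarith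
    then have "real ((k - 1) mod q0) * \<omega> / real m \<le> 1" using pcD(14) by simp
    then have "8 * \<epsilon> * (real ((k - 1) mod q0) * \<omega> / real m) \<le> 8 * \<epsilon> * 1"
      using \<open>0 < \<epsilon>\<close> by (intro mult_left_mono) auto
    moreover have "real ((k - 1) mod q0) * (8 * (L * \<psi>)\<^sup>2 / (real m * \<mu>))
        = 8 * \<epsilon> * (real ((k - 1) mod q0) * \<omega> / real m)"
      unfolding L\<psi> \<mu>_def using \<open>0 < \<epsilon>\<close> \<omega> by (simp add: power2_eq_square)
    ultimately show ?thesis by simp
  qed
  have "(\<integral>\<^sup>+\<omega>. ennreal (infnorm (error k \<omega>)) \<partial>M) \<le> (\<integral>\<^sup>+\<omega>. ennreal (soft_infnorm \<mu> (error k \<omega>)) \<partial>M)"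
    by (intro nn_integral_mono ennreal_leI infnorm_le_soft_infnorm \<open>0 < \<mu>\<close>)
  also have "\<dots> \<le> ennreal (\<mu> * ln (2 * real CARD('d)) + 2 * \<sigma>\<^sup>2 / (real m1 * \<mu>)
        + real ((k - 1) mod q0) * (8 * (L * \<psi>)\<^sup>2 / (real m * \<mu>)))"
    by (rule nn_integral_soft_infnorm_error_bound[OF k \<open>0 < \<mu>\<close>])
  also have "\<dots> \<le> ennreal (10 * \<epsilon>)" using 1 2 3 by (intro ennreal_leI) linarith
  finally show ?thesis .
qed

text \<open>The three contributions are 3 L \<psi> = 3 \<epsilon>, twice the error bound 10
  \<epsilon>, and \<Delta> / (K \<psi>) \<le> \<epsilon>, the last because K \<ge> \<Delta> L /
  \<epsilon>^2.\<close>

lemma (in l1_ball_run) output_residual_le: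
  assumes pc: "parameter_choice CARD('d) L \<sigma> \<Delta> \<epsilon> \<eta> \<psi> K q0 m1 m" and "0 < \<epsilon>"
    and int: "integrable M (\<lambda>\<omega>. f (x 1 \<omega>))" and \<Delta>: "\<Delta> = (\<integral>\<omega>. f (x 1 \<omega>) \<partial>M) - f_low"
  shows "(\<integral>\<^sup>+\<omega>. infnorm_dist0
      (frechet_subdifferential (\<lambda>y. ereal (f y) + ind_fun X y) (x (Y \<omega> + 1) \<omega>)) \<partial>M)
    \<le> ennreal (24 * \<epsilon>)"
proof -
  note pcD = parameter_choiceD[OF pc \<open>0 < \<epsilon>\<close> zero_less_card_finite sigma_nonneg]
  have \<psi>: "\<psi> = \<epsilon> / L" using pc by (simp add: parameter_choice_def)
  have "\<Delta> / \<psi> = \<Delta> * L / \<epsilon>\<^sup>2 * \<epsilon>" using \<open>0 < \<epsilon>\<close> by (simp add: \<psi> power2_eq_square)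
  also have "\<dots> \<le> real K * \<epsilon>" using \<open>0 < \<epsilon>\<close> by (intro mult_right_mono pcD(5)) simp
  finally have \<Delta>\<psi>: "\<Delta> / \<psi> \<le> real K * \<epsilon>" .
  have "(\<integral>\<^sup>+\<omega>. infnorm_dist0
      (frechet_subdifferential (\<lambda>y. ereal (f y) + ind_fun X y) (x (Y \<omega> + 1) \<omega>)) \<partial>M)
    \<le> ennreal (1 / real K) * (\<Sum>k=1..K. \<integral>\<^sup>+\<omega>. residual_bound (x (k + 1) \<omega>) \<partial>M)"
    by (rule nn_integral_output_residual_le)
  also have "\<dots> \<le> ennreal (1 / real K) * ennreal (real K * (3 * L * \<psi> + 2 * (10 * \<epsilon>)) + \<Delta> / \<psi>)"
    unfolding \<Delta> using \<open>0 < \<epsilon>\<close>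
    by (intro mult_left_mono nn_integral_sum_residual_bound_le int nn_integral_infnorm_error_le[OF pc]) auto
  also have "\<dots> \<le> ennreal (1 / real K) * ennreal (real K * (24 * \<epsilon>))"
    using \<Delta>\<psi> L_pos by (intro mult_left_mono ennreal_leI) (auto simp: \<psi> algebra_simps)
  also have "\<dots> = ennreal (24 * \<epsilon>)"
    using \<open>0 < \<epsilon>\<close> pcD(11) by (simp flip: ennreal_mult')
  finally show ?thesis .
qed

text \<open>The starting point is fixed before \<epsilon>, since \<Delta> depends on it. The order
  bound is read as \<epsilon> tends to 0 with the data fixed: the threshold depends on the data, the
  constant does not. For large \<epsilon> the ceilings would dominate the stated expression.\<close>

theorem corollary6:
  fixes X :: "(real ^ 'd) set"
    and \<Xi> :: "'z::euclidean_space set"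
    and D :: "'z measure"
    and F :: "real ^ 'd \<Rightarrow> 'z \<Rightarrow> real"
    and L \<sigma> f_low \<Delta> :: real
    and M :: "'w measure"
    and x1 :: "'w \<Rightarrow> real ^ 'd"
  assumes "stochastic_problem X \<Xi> D F L \<sigma> f_low"
    and "prob_space M"
    and "x1 \<in> borel_measurable M"
    and "\<forall>\<omega>\<in>space M. x1 \<omega> \<in> X"
    and "integrable M (\<lambda>\<omega>. objective D F (x1 \<omega>))"
    and "\<Delta> = (\<integral>\<omega>. objective D F (x1 \<omega>) \<partial>M) - f_low"
  shows "(\<forall>\<epsilon>>0. \<forall>\<eta> \<psi> K q0 m1 m \<zeta> G x Y.
        parameter_choice CARD('d) L \<sigma> \<Delta> \<epsilon> \<eta> \<psi> K q0 m1 m \<longrightarrow>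
        0 < \<psi> \<longrightarrow>
        variance_reduced_method M X D F (ind_fun {z. l1_norm z \<le> \<psi>}) (\<lambda>_. \<eta>) (\<lambda>_. 1 / real K)
          K q0 m1 m \<zeta> G x Y \<longrightarrow>
        (\<forall>\<omega>\<in>space M. x 1 \<omega> = x1 \<omega>) \<longrightarrow>
        (\<integral>\<^sup>+\<omega>. infnorm_dist0
            (frechet_subdifferential (\<lambda>y. ereal (objective D F y) + ind_fun X y) (x (Y \<omega> + 1) \<omega>)) \<partial>M)
          \<le> ennreal (C3 * \<epsilon>)) \<and>
      (\<forall>\<^sub>F \<epsilon> in at_right 0. \<forall>\<eta> \<psi> K q0 m1 m.
        parameter_choice CARD('d) L \<sigma> \<Delta> \<epsilon> \<eta> \<psi> K q0 m1 m \<longrightarrow>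
        real (sample_complexity q0 m1 m K)
          \<le> C_complexity * (\<Delta> * L * (ln (real CARD('d)))\<^sup>2 * \<sigma> / \<epsilon> ^ 3))"
proof (intro conjI allI impI)
  interpret P: stochastic_problem X \<Xi> D F L \<sigma> f_low by fact
  fix \<epsilon> \<eta> \<psi> :: real and K q0 m1 m \<zeta> G x and Y :: "'w \<Rightarrow> nat"
  assume "0 < \<epsilon>" and pc: "parameter_choice CARD('d) L \<sigma> \<Delta> \<epsilon> \<eta> \<psi> K q0 m1 m" and "0 < \<psi>"
    and run: "variance_reduced_method M X D F (ind_fun {z. l1_norm z \<le> \<psi>}) (\<lambda>_. \<eta>) (\<lambda>_. 1 / real K)
          K q0 m1 m \<zeta> G x Y"
    and x1: "\<forall>\<omega>\<in>space M. x 1 \<omega> = x1 \<omega>"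
  \<comment> \<open>Division by 0 yields 0, so a positive radius \<epsilon> / L excludes L =
    0.\<close>
  have "0 < L" using pc \<open>0 < \<psi>\<close> \<open>0 < \<epsilon>\<close> by (simp add: parameter_choice_def zero_less_divide_iff)
  have "\<eta> = 1 / L" using pc by (simp add: parameter_choice_def)
  then have "l1_ball_run X \<Xi> D F L \<sigma> f_low M K q0 m1 m \<zeta> G x Y \<psi>"
    unfolding l1_ball_run_def l1_ball_run_axioms_def
    using P.stochastic_problem_axioms run \<open>0 < \<psi>\<close> \<open>0 < L\<close> by simp
  then interpret R: l1_ball_run X \<Xi> D F L \<sigma> f_low M K q0 m1 m \<zeta> G x Y \<psi> .
  have "integrable M (\<lambda>\<omega>. objective D F (x 1 \<omega>))"
    using assms(5) x1 by (simp cong: Bochner_Integration.integrable_cong)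
  moreover have "\<Delta> = (\<integral>\<omega>. objective D F (x 1 \<omega>) \<partial>M) - f_low"
    using assms(6) x1 by (simp cong: Bochner_Integration.integral_cong)
  ultimately have "(\<integral>\<^sup>+\<omega>. infnorm_dist0
            (frechet_subdifferential (\<lambda>y. ereal (objective D F y) + ind_fun X y) (x (Y \<omega> + 1) \<omega>)) \<partial>M)
          \<le> ennreal (24 * \<epsilon>)"
    by (rule R.output_residual_le[OF pc \<open>0 < \<epsilon>\<close>])
  also have "\<dots> \<le> ennreal (C3 * \<epsilon>)" using \<open>0 < \<epsilon>\<close> by (intro ennreal_leI) (simp add: C3_def)
  finally show "(\<integral>\<^sup>+\<omega>. infnorm_dist0
            (frechet_subdifferential (\<lambda>y. ereal (objective D F y) + ind_fun X y) (x (Y \<omega> + 1) \<omega>)) \<partial>M)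
          \<le> ennreal (C3 * \<epsilon>)" .
next
  interpret P: stochastic_problem X \<Xi> D F L \<sigma> f_low by fact
  \<comment> \<open>The entries \<sigma> and \<Delta> L / (4 \<sigma>) give two of the smallness
    conditions; 1 and \<Delta> L / 2 together give the third, through \<epsilon>^2 \<le>
    \<epsilon>.\<close>
  define b where "b = min (min 1 \<sigma>) (min (\<Delta> * L / (4 * \<sigma>)) (\<Delta> * L / 2))"
  show "\<forall>\<^sub>F \<epsilon> in at_right 0. \<forall>\<eta> \<psi> K q0 m1 m.
        parameter_choice CARD('d) L \<sigma> \<Delta> \<epsilon> \<eta> \<psi> K q0 m1 m \<longrightarrow>
        real (sample_complexity q0 m1 m K)
          \<le> C_complexity * (\<Delta> * L * (ln (real CARD('d)))\<^sup>2 * \<sigma> / \<epsilon> ^ 3)"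
  proof (cases "0 < \<Delta> * L \<and> 0 < \<sigma>")
    case True
    then have "0 < b" by (simp add: b_def)
    show ?thesis
      unfolding eventually_at_right_field
    proof (intro exI[of _ b] conjI allI impI \<open>0 < b\<close>)
      fix \<epsilon> \<eta> \<psi> K q0 m1 m
      assume \<epsilon>: "0 < \<epsilon>" "\<epsilon> < b" and pc: "parameter_choice CARD('d) L \<sigma> \<Delta> \<epsilon> \<eta> \<psi> K q0 m1 m"
      have "\<epsilon>\<^sup>2 \<le> \<epsilon>" using \<epsilon> by (simp add: b_def power2_eq_square mult_le_cancel_left1)
      then show "real (sample_complexity q0 m1 m K)
          \<le> C_complexity * (\<Delta> * L * (ln (real CARD('d)))\<^sup>2 * \<sigma> / \<epsilon> ^ 3)"
        using \<epsilon> True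
        by (intro sample_complexity_parameter_choice_le[OF pc]) (auto simp: b_def pos_less_divide_eq mult_ac)
    qed
  next
    case False
    \<comment> \<open>For degenerate data \<open>K\<close> or \<open>m1\<close> would be 0, so there
      is no admissible choice and the claim is vacuous.\<close>
    have "\<not> parameter_choice CARD('d) L \<sigma> \<Delta> \<epsilon> \<eta> \<psi> K q0 m1 m" if "0 < \<epsilon>" for \<epsilon> \<eta> \<psi> K q0 m1 m
      using parameter_choiceD(2,3)[OF _ that zero_less_card_finite P.sigma_nonneg] False by blast
    then show ?thesis
      unfolding eventually_at_right_field by (intro exI[of _ 1]) auto
  qed
qed

end
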